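(* Let $M_t\subset(M,\tau)$ be a filtration of finite von Neumann algebras containing an adapted free Brownian motion $S_t=(S^1_t,\dots,S^m_t)$. Let $T>0$ and $t_0=0<t_1<t_2<\dots<t_k\le t_{k+1}=T$ with $|t_{i+1}-t_i|\le1$. For $t\in\,]t_i,t_{i+1}]$ let $h_t:L^2_{sa}(M_t,\tau)^{m(i+1)}\to\mathbb R$ be a convex function bounded below by $c\in\mathbb R$ (uniformly in $t$), with $h_t(X)\le|c|(1+\|X\|_2^2)$, and such that for some $C,D>0$ and all $X,Y\in L^2_{sa}(M_t,\tau)^{m(i+1)}$ $$|h_t(X)-h_t(Y)|\le\|X-Y\|_2\,(C\|X\|_2+C\|Y\|_2+D).$$ Assume $h_t$ is Gâteaux differentiable, that $t\mapsto\nabla_{i+1}h_t(X)$ is continuous with values in $L^2_{sa}(M,\tau)^m$ on any $]t_i,t_{i+1}[$, that for $X\in L^2_{sa}(M_u)^{m(i+1)}$, $u<t$, we have $\nabla_{i+1}h_t(X)\in L^2_{sa}(M_u)^m$, and that for some $\alpha,\beta\in\,]0,1]$ and any $t<s$ in $]t_i,t_{i+1}[$ and $X,Y\in L^2_{sa}(M_t,\tau)^{m(i+1)}$, $$\|\nabla_{i+1}h_t(X)-\nabla_{i+1}h_s(X)\|_2\le|t-s|^\alpha(C+D\|X\|_2),$$ $$\|\nabla_{i+1}h_t(X)-\nabla_{i+1}h_t(Y)\|_2\le\|X-Y\|_2^\beta(C+D\|X\|_2+D\|Y\|_2).$$ Let finally $X_0\in L^2_{sa}(M_0,\tau)^m$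 and $L>0$. Then there is $X_t\in L^2_{sa}(M_t,\tau)^m$, continuous in $t\in[0,T]$, satisfying $$X_t=X_0+S_t+\int_0^t\big(LX_s-u_s(X)\big)ds,\qquad u_s(X)=\sum_{i=0}^k\nabla_{i+1}h_s(X_{t_1},\dots,X_{t_i},X_s)1_{]t_i,t_{i+1}]}(s).$$ Moreover, any continuous solution $Y_t\in L^2_{sa}(M_t,\tau)^m$ of this equation equals $X_t$ for every $t\in[0,T]$ if $Y_0=X_0$.
   Context: $(M,\tau)$ is a tracial von Neumann algebra; $L^2_{sa}$ denotes the self-adjoint part of $L^2$; $\|\cdot\|_2$ is the $L^2$-norm on tuples, $\|X\|_2^2=\sum\tau(X_j^*X_j)$. An adapted free Brownian motion $S$ for the filtration $(M_t)$ is an $m$-tuple of self-adjoint adapted processes with $S_0=0$ whose increments $S_t-S_s$ are $m$-tuples of free semicircular variables of covariance $(t-s)\mathrm{Id}$, with $\{S_u-S_s:u\ge s\}$ free from $M_s$. For a function of $i+1$ arguments, each an $m$-tuple, $\nabla_{i+1}$ is the $L^2$-gradient with respect to the $(i+1)$-th (last) $m$-tuple. *)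

theory Defs
  imports "HOL-Analysis.Analysis" "HOL-Library.Function_Algebras"
begin

section \<open>Complex Hilbert spaces and their bounded operators\<close>

text \<open>The complex inner product is conjugate linear in its first argument; its real part is the
  inner product of the underlying real Hilbert space.\<close>

class complex_hilbert = real_inner + banach +
  fixes scaleC :: "complex \<Rightarrow> 'a \<Rightarrow> 'a"
    and cinner :: "'a \<Rightarrow> 'a \<Rightarrow> complex"
  assumes scaleC_of_real: "scaleC (of_real r) x = r *\<^sub>R x"
    and scaleC_add_right: "scaleC a (x + y) = scaleC a x + scaleC a y"
    and scaleC_add_left: "scaleC (a + b) x = scaleC a x + scaleC b x"
    and scaleC_scaleC: "scaleC a (scaleC b x) = scaleC (a * b) x"
    and cinner_commute: "cinner x y = cnj (cinner y x)"
    and cinner_add_right: "cinner x (y + z) = cinner x y + cinner x z"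
    and cinner_scaleC_right: "cinner x (scaleC a y) = a * cinner x y"
    and inner_eq_Re_cinner: "inner x y = Re (cinner x y)"

text \<open>The type \<open>'h \<Rightarrow>\<^sub>L 'h\<close> consists of the bounded operators that are linear over the reals.\<close>

definition clinear_ops :: "('h::complex_hilbert \<Rightarrow>\<^sub>L 'h) set" where
  "clinear_ops = {a. \<forall>c x. blinfun_apply a (scaleC c x) = scaleC c (blinfun_apply a x)}"

definition adj :: "('h::complex_hilbert \<Rightarrow>\<^sub>L 'h) \<Rightarrow> ('h \<Rightarrow>\<^sub>L 'h)" where
  "adj a = (THE b. \<forall>x y. cinner (blinfun_apply b x) y = cinner x (blinfun_apply a y))"

definition cscale_op :: "complex \<Rightarrow> ('h::complex_hilbert \<Rightarrow>\<^sub>L 'h) \<Rightarrow> ('h \<Rightarrow>\<^sub>L 'h)" where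
  "cscale_op c a = Blinfun (\<lambda>x. scaleC c (a x))"

definition pow_op :: "('h::complex_hilbert \<Rightarrow>\<^sub>L 'h) \<Rightarrow> nat \<Rightarrow> ('h \<Rightarrow>\<^sub>L 'h)" where
  "pow_op a n = ((\<lambda>b. a o\<^sub>L b) ^^ n) id_blinfun"

definition self_adjoint_part :: "('h::complex_hilbert \<Rightarrow>\<^sub>L 'h) set \<Rightarrow> ('h \<Rightarrow>\<^sub>L 'h) set" where
  "self_adjoint_part A = {a \<in> A. adj a = a}"

text \<open>The operator order; only used for self-adjoint operators.\<close>

definition op_le :: "('h::complex_hilbert \<Rightarrow>\<^sub>L 'h) \<Rightarrow> ('h \<Rightarrow>\<^sub>L 'h) \<Rightarrow> bool" where
  "op_le a b \<longleftrightarrow> (\<forall>x. Re (cinner x (a x)) \<le> Re (cinner x (b x)))"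


section \<open>Tracial von Neumann algebras\<close>

definition commutant :: "('h::complex_hilbert \<Rightarrow>\<^sub>L 'h) set \<Rightarrow> ('h \<Rightarrow>\<^sub>L 'h) set" where
  "commutant A = {b \<in> clinear_ops. \<forall>a\<in>A. a o\<^sub>L b = b o\<^sub>L a}"

definition von_neumann_algebra :: "('h::complex_hilbert \<Rightarrow>\<^sub>L 'h) set \<Rightarrow> bool" where
  "von_neumann_algebra A \<longleftrightarrow>
     A \<subseteq> clinear_ops \<and> (\<forall>a\<in>A. adj a \<in> A) \<and> commutant (commutant A) = A"

text \<open>Normality: preservation of suprema of upward directed families of self-adjoint elements.\<close>

definition normal_functional ::
  "('h::complex_hilbert \<Rightarrow>\<^sub>L 'h) set \<Rightarrow> (('h \<Rightarrow>\<^sub>L 'h) \<Rightarrow> complex) \<Rightarrow> bool" where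
  "normal_functional M \<tau> \<longleftrightarrow>
     (\<forall>D a. D \<noteq> {} \<and> D \<subseteq> self_adjoint_part M
        \<and> (\<forall>x\<in>D. \<forall>y\<in>D. \<exists>z\<in>D. op_le x z \<and> op_le y z)
        \<and> a \<in> self_adjoint_part M \<and> (\<forall>x\<in>D. op_le x a)
        \<and> (\<forall>b\<in>self_adjoint_part M. (\<forall>x\<in>D. op_le x b) \<longrightarrow> op_le a b)
      \<longrightarrow> Re (\<tau> a) = (SUP x\<in>D. Re (\<tau> x)))"

definition tracial_von_neumann_algebra ::
  "('h::complex_hilbert \<Rightarrow>\<^sub>L 'h) set \<Rightarrow> (('h \<Rightarrow>\<^sub>L 'h) \<Rightarrow> complex) \<Rightarrow> bool" where
  "tracial_von_neumann_algebra M \<tau> \<longleftrightarrow>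
     von_neumann_algebra M
   \<and> (\<forall>a\<in>M. \<forall>b\<in>M. \<tau> (a + b) = \<tau> a + \<tau> b)
   \<and> (\<forall>c. \<forall>a\<in>M. \<tau> (cscale_op c a) = c * \<tau> a)
   \<and> \<tau> id_blinfun = 1
   \<and> (\<forall>a\<in>M. Im (\<tau> (adj a o\<^sub>L a)) = 0 \<and> 0 \<le> Re (\<tau> (adj a o\<^sub>L a)))
   \<and> (\<forall>a\<in>M. \<tau> (adj a o\<^sub>L a) = 0 \<longrightarrow> a = 0)
   \<and> (\<forall>a\<in>M. \<forall>b\<in>M. \<tau> (a o\<^sub>L b) = \<tau> (b o\<^sub>L a))
   \<and> normal_functional M \<tau>"

text \<open>Every member is unital with the unit of \<open>M\<close>, and finite by means of the restricted trace.\<close>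

definition vn_filtration ::
  "('h::complex_hilbert \<Rightarrow>\<^sub>L 'h) set \<Rightarrow> (real \<Rightarrow> ('h \<Rightarrow>\<^sub>L 'h) set) \<Rightarrow> bool" where
  "vn_filtration M Mt \<longleftrightarrow>
     (\<forall>t\<ge>0. von_neumann_algebra (Mt t) \<and> Mt t \<subseteq> M)
   \<and> (\<forall>s t. 0 \<le> s \<and> s \<le> t \<longrightarrow> Mt s \<subseteq> Mt t)"


section \<open>The space \<open>L\<^sup>2(M, \<tau>)\<close> and its self-adjoint part\<close>

text \<open>
  \<open>L\<^sup>2(M, \<tau>)\<close> is the Hilbert space completion of \<open>M\<close> for \<open>\<langle>a, b\<rangle> = \<tau>(a\<^sup>* b)\<close>. It is
  given by a complete space, the type \<open>'l\<close>, and a complex linear inner product preserving map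
  \<open>\<iota>\<close> of \<open>M\<close> onto a dense subspace; this determines \<open>('l, \<iota>)\<close> up to a unique unitary.
\<close>

definition L2_completion ::
  "('h::complex_hilbert \<Rightarrow>\<^sub>L 'h) set \<Rightarrow> (('h \<Rightarrow>\<^sub>L 'h) \<Rightarrow> complex)
    \<Rightarrow> (('h \<Rightarrow>\<^sub>L 'h) \<Rightarrow> 'l::complex_hilbert) \<Rightarrow> bool" where
  "L2_completion M \<tau> \<iota> \<longleftrightarrow>
     (\<forall>a\<in>M. \<forall>b\<in>M. \<iota> (a + b) = \<iota> a + \<iota> b)
   \<and> (\<forall>c. \<forall>a\<in>M. \<iota> (cscale_op c a) = scaleC c (\<iota> a))
   \<and> (\<forall>a\<in>M. \<forall>b\<in>M. cinner (\<iota> a) (\<iota> b) = \<tau> (adj a o\<^sub>L b))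
   \<and> closure (\<iota> ` M) = UNIV"

text \<open>The continuous extension to \<open>L\<^sup>2(M, \<tau>)\<close> of the adjoint on \<open>M\<close>; it is conjugate linear, hence
  only real linearity can be asked for.\<close>

definition L2_star ::
  "('h::complex_hilbert \<Rightarrow>\<^sub>L 'h) set \<Rightarrow> (('h \<Rightarrow>\<^sub>L 'h) \<Rightarrow> 'l::complex_hilbert) \<Rightarrow> 'l \<Rightarrow> 'l" where
  "L2_star M \<iota> = (THE J. bounded_linear J \<and> (\<forall>a\<in>M. J (\<iota> a) = \<iota> (adj a)))"

text \<open>For a von Neumann subalgebra \<open>A\<close> of \<open>M\<close>, the space \<open>L\<^sup>2(A, \<tau>)\<close> is the closure of \<open>A\<close> in
  \<open>L\<^sup>2(M, \<tau>)\<close>. The second set below is \<open>L\<^sup>2\<^sub>s\<^sub>a(A, \<tau>)\<^sup>m\<close>, with \<open>m\<close> the cardinality of \<open>'m\<close>; the norm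
  and inner product of the type \<open>'l ^ 'm\<close> are the \<open>L\<^sup>2\<close> ones on \<open>m\<close>-tuples.\<close>

definition L2_sa ::
  "('h::complex_hilbert \<Rightarrow>\<^sub>L 'h) set \<Rightarrow> (('h \<Rightarrow>\<^sub>L 'h) \<Rightarrow> 'l::complex_hilbert)
    \<Rightarrow> ('h \<Rightarrow>\<^sub>L 'h) set \<Rightarrow> 'l set" where
  "L2_sa M \<iota> A = {x \<in> closure (\<iota> ` A). L2_star M \<iota> x = x}"

definition L2_sa_vec ::
  "('h::complex_hilbert \<Rightarrow>\<^sub>L 'h) set \<Rightarrow> (('h \<Rightarrow>\<^sub>L 'h) \<Rightarrow> 'l::complex_hilbert)
    \<Rightarrow> ('h \<Rightarrow>\<^sub>L 'h) set \<Rightarrow> ('l ^ 'm) set" where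
  "L2_sa_vec M \<iota> A = {X. \<forall>j. X $ j \<in> L2_sa M \<iota> A}"


section \<open>Freeness and free Brownian motion\<close>

definition unital_star_subalgebra :: "('h::complex_hilbert \<Rightarrow>\<^sub>L 'h) set \<Rightarrow> bool" where
  "unital_star_subalgebra B \<longleftrightarrow>
     B \<subseteq> clinear_ops \<and> id_blinfun \<in> B
   \<and> (\<forall>a\<in>B. \<forall>b\<in>B. a + b \<in> B \<and> a o\<^sub>L b \<in> B)
   \<and> (\<forall>c. \<forall>a\<in>B. cscale_op c a \<in> B)
   \<and> (\<forall>a\<in>B. adj a \<in> B)"

definition star_algebra_generated :: "('h::complex_hilbert \<Rightarrow>\<^sub>L 'h) set \<Rightarrow> ('h \<Rightarrow>\<^sub>L 'h) set" where
  "star_algebra_generated A = \<Inter> {B. unital_star_subalgebra B \<and> A \<subseteq> B}"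

text \<open>Freeness of the sets \<open>A i\<close>: the trace vanishes on alternating products of centred elements of
  the unital star-algebras they generate.\<close>

definition free_family ::
  "(('h::complex_hilbert \<Rightarrow>\<^sub>L 'h) \<Rightarrow> complex) \<Rightarrow> ('i \<Rightarrow> ('h \<Rightarrow>\<^sub>L 'h) set) \<Rightarrow> bool" where
  "free_family \<tau> A \<longleftrightarrow>
     (\<forall>w :: ('i \<times> ('h \<Rightarrow>\<^sub>L 'h)) list.
        w \<noteq> [] \<and> distinct_adj (map fst w)
        \<and> (\<forall>(i, a)\<in>set w. a \<in> star_algebra_generated (A i) \<and> \<tau> a = 0)
        \<longrightarrow> \<tau> (foldr (\<lambda>p b. snd p o\<^sub>L b) w id_blinfun) = 0)"

text \<open>A self-adjoint element whose distribution is the centred semicircle law of variance \<open>v > 0\<close>,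
  i.e. the law of density \<open>sqrt (4 v - x\<^sup>2) / (2 \<pi> v)\<close> on \<open>[- 2 sqrt v, 2 sqrt v]\<close>.\<close>

definition semicircular ::
  "(('h::complex_hilbert \<Rightarrow>\<^sub>L 'h) \<Rightarrow> complex) \<Rightarrow> real \<Rightarrow> ('h \<Rightarrow>\<^sub>L 'h) \<Rightarrow> bool" where
  "semicircular \<tau> v a \<longleftrightarrow> adj a = a \<and>
     (\<forall>n. \<tau> (pow_op a n) =
        of_real (integral {- 2 * sqrt v .. 2 * sqrt v}
                   (\<lambda>x. x ^ n * (sqrt (4 * v - x\<^sup>2) / (2 * pi * v)))))"

text \<open>Freeness of the components of an increment together with their variances says that the
  increment is a free semicircular tuple of covariance \<open>(t - s) Id\<close>.\<close>

definition adapted_free_brownian_motion ::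
  "(('h::complex_hilbert \<Rightarrow>\<^sub>L 'h) \<Rightarrow> complex) \<Rightarrow> (real \<Rightarrow> ('h \<Rightarrow>\<^sub>L 'h) set)
    \<Rightarrow> (real \<Rightarrow> 'm \<Rightarrow> ('h \<Rightarrow>\<^sub>L 'h)) \<Rightarrow> bool" where
  "adapted_free_brownian_motion \<tau> Mt S \<longleftrightarrow>
     (\<forall>j. S 0 j = 0)
   \<and> (\<forall>t\<ge>0. \<forall>j. S t j \<in> self_adjoint_part (Mt t))
   \<and> (\<forall>s t. 0 \<le> s \<and> s < t \<longrightarrow>
        (\<forall>j. semicircular \<tau> (t - s) (S t j - S s j))
        \<and> free_family \<tau> (\<lambda>j. {S t j - S s j}))
   \<and> (\<forall>s\<ge>0. free_family \<tau>
        (\<lambda>b. if b then Mt s else {S u j - S s j |u j. s \<le> u}))"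

definition L2_vec :: "(('h::complex_hilbert \<Rightarrow>\<^sub>L 'h) \<Rightarrow> 'l::complex_hilbert)
    \<Rightarrow> ('m \<Rightarrow> ('h \<Rightarrow>\<^sub>L 'h)) \<Rightarrow> 'l ^ 'm" where
  "L2_vec \<iota> a = (\<chi> j. \<iota> (a j))"


section \<open>Functions of several \<open>m\<close>-tuples\<close>

instantiation "fun" :: (type, real_vector) real_vector
begin

definition scaleR_fun :: "real \<Rightarrow> ('a \<Rightarrow> 'b) \<Rightarrow> 'a \<Rightarrow> 'b" where
  "scaleR_fun r f = (\<lambda>x. r *\<^sub>R f x)"

instance
  by standard (auto simp: scaleR_fun_def plus_fun_def fun_eq_iff algebra_simps)

end

text \<open>An element \<open>(X\<^sub>1, \<dots>, X\<^sub>i\<^sub>+\<^sub>1)\<close> of \<open>V\<^sup>i\<^sup>+\<^sup>1\<close> is encoded by a sequence with entries indexed by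
  \<open>0, \<dots>, i\<close> and continued by zero, so that the pointwise vector space structure applies.\<close>

definition tuples :: "'v::real_vector set \<Rightarrow> nat \<Rightarrow> (nat \<Rightarrow> 'v) set" where
  "tuples V i = {X. (\<forall>j\<le>i. X j \<in> V) \<and> (\<forall>j>i. X j = 0)}"

definition tuple_norm :: "nat \<Rightarrow> (nat \<Rightarrow> 'v::real_normed_vector) \<Rightarrow> real" where
  "tuple_norm i X = sqrt (\<Sum>j\<le>i. (norm (X j))\<^sup>2)"

text \<open>Gateaux differentiability at \<open>X\<close> of a function on the \<open>(i + 1)\<close>-fold power of a space \<open>V\<close>:
  the directional derivative is a bounded linear functional of the direction.\<close>

definition gateaux_differentiable ::
  "'v::real_normed_vector set \<Rightarrow> nat \<Rightarrow> ((nat \<Rightarrow> 'v) \<Rightarrow> real) \<Rightarrow> (nat \<Rightarrow> 'v) \<Rightarrow> bool" where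
  "gateaux_differentiable V i f X \<longleftrightarrow>
     (\<exists>f' K. (\<forall>Y\<in>tuples V i. \<forall>Z\<in>tuples V i. f' (Y + Z) = f' Y + f' Z)
        \<and> (\<forall>r. \<forall>Y\<in>tuples V i. f' (r *\<^sub>R Y) = r * f' Y)
        \<and> (\<forall>Y\<in>tuples V i. \<bar>f' Y\<bar> \<le> K * tuple_norm i Y)
        \<and> (\<forall>Y\<in>tuples V i.
              ((\<lambda>\<epsilon>. f (X + \<epsilon> *\<^sub>R Y)) has_real_derivative f' Y) (at 0)))"

text \<open>The gradient \<open>\<nabla>\<^sub>i\<^sub>+\<^sub>1 f (X)\<close> with respect to the last entry (index \<open>i\<close>), taken in the Hilbert
  space \<open>V\<close>.\<close>

definition last_gradient ::
  "'v::real_inner set \<Rightarrow> nat \<Rightarrow> ((nat \<Rightarrow> 'v) \<Rightarrow> real) \<Rightarrow> (nat \<Rightarrow> 'v) \<Rightarrow> 'v" where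
  "last_gradient V i f X =
     (THE G. G \<in> V \<and> (\<forall>Z\<in>V.
        ((\<lambda>\<epsilon>. f (X + \<epsilon> *\<^sub>R (\<lambda>j. if j = i then Z else 0))) has_real_derivative inner G Z) (at 0)))"


section \<open>The stochastic differential equation\<close>

text \<open>The tuple \<open>(X\<^bsub>p 1\<^esub>, \<dots>, X\<^bsub>p i\<^esub>, X\<^sub>s)\<close>.\<close>

definition path_tuple :: "(nat \<Rightarrow> real) \<Rightarrow> nat \<Rightarrow> (real \<Rightarrow> 'v::zero) \<Rightarrow> real \<Rightarrow> nat \<Rightarrow> 'v" where
  "path_tuple p i X s = (\<lambda>j. if j < i then X (p (Suc j)) else if j = i then X s else 0)"

text \<open>Here \<open>V s\<close> stands for \<open>L\<^sup>2\<^sub>s\<^sub>a(M\<^sub>s, \<tau>)\<^sup>m\<close>.\<close>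

definition drift ::
  "(real \<Rightarrow> 'v::real_inner set) \<Rightarrow> (real \<Rightarrow> (nat \<Rightarrow> 'v) \<Rightarrow> real) \<Rightarrow> (nat \<Rightarrow> real) \<Rightarrow> nat
    \<Rightarrow> (real \<Rightarrow> 'v) \<Rightarrow> real \<Rightarrow> 'v" where
  "drift V h p k X s =
     (\<Sum>i\<le>k. indicator {p i<..p (Suc i)} s *\<^sub>R
        last_gradient (V s) i (h s) (path_tuple p i X s))"

text \<open>A continuous adapted solution on \<open>[0, T]\<close> with initial value \<open>x\<^sub>0\<close>; the existence of the
  integral is part of the equation.\<close>

definition continuous_solution ::
  "(real \<Rightarrow> 'v::real_inner set) \<Rightarrow> (real \<Rightarrow> (nat \<Rightarrow> 'v) \<Rightarrow> real) \<Rightarrow> (nat \<Rightarrow> real) \<Rightarrow> nat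
    \<Rightarrow> real \<Rightarrow> real \<Rightarrow> (real \<Rightarrow> 'v) \<Rightarrow> 'v \<Rightarrow> (real \<Rightarrow> 'v) \<Rightarrow> bool" where
  "continuous_solution V h p k T L S x\<^sub>0 X \<longleftrightarrow>
     (\<forall>t\<in>{0..T}. X t \<in> V t)
   \<and> continuous_on {0..T} X
   \<and> (\<forall>t\<in>{0..T}. (\<lambda>s. L *\<^sub>R X s - drift V h p k X s) integrable_on {0..t}
        \<and> X t = x\<^sub>0 + S t + integral {0..t} (\<lambda>s. L *\<^sub>R X s - drift V h p k X s))"

end

theory Submission
  imports Defs
begin

text \<open>Once the past values \<open>X\<^bsub>t\<^sub>1\<^esub>, \<dots>, X\<^bsub>t\<^sub>i\<^esub>\<close> are frozen, the equation on \<open>]t\<^sub>i, t\<^sub>i\<^sub>+\<^sub>1]\<close> has a drift \<open>L x - G\<^sub>s x\<close> in which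
  \<open>G\<^sub>s\<close>, the gradient of a convex function, is monotone, of linear growth and uniformly continuous
  on bounded sets. Monotonicity gives
  \<open>(\<parallel>x - y\<parallel>\<^sup>2)' \<le> 2 L \<parallel>x - y\<parallel>\<^sup>2\<close> for the difference of two solutions, hence uniqueness. The same
  estimate, with a small defect, shows that the solutions of the equations with delayed drift
  \<open>(L x - G\<^sub>s x)(X\<^bsub>s - \<delta>\<^esub>)\<close> (Tonelli's approximations, constructed step by step without any fixed point
  theorem) form a uniform Cauchy family as \<open>\<delta>\<close> tends to 0. Delaying the argument preserves adaptedness
  because \<open>L\<^sup>2\<^sub>s\<^sub>a(M\<^sub>s)\<close> increases with \<open>s\<close>. Of the free Brownian motion only adaptedness and
  continuity in \<open>L\<^sup>2\<close> matter; the latter comes from its zeroth and second moments.\<close>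

section \<open>Closed subspaces of real Hilbert spaces\<close>

text \<open>All comparisons of paths therefore rest on monotonicity, the sum of two subgradient
  inequalities. It compares undelayed states at equal times, so a delayed drift is written as the
  undelayed one plus a defect; the defect is uniformly small because the approximations share a
  bound and a modulus of continuity that do not depend on the delay. The Hilbert space moves as
  well: the gradient at time \<open>t\<close> is the vector representing a derivative inside
  \<open>V t\<close>. This calls for the Riesz theorem on closed subspaces, and it forces gradients
  at different times to be compared at a state of the earlier, smaller space. Finally, the Hoelder
  estimates hold on open time intervals.\<close>

lemma Riesz_closed_subspace:
  fixes V :: "'a::{real_inner,banach} set" and f :: "'a \<Rightarrow> real"
  assumes V: "subspace V" "closed V"
    and add: "\<And>x y. x \<in> V \<Longrightarrow> y \<in> V \<Longrightarrow> f (x + y) = f x + f y"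
    and scale: "\<And>r x. x \<in> V \<Longrightarrow> f (r *\<^sub>R x) = r * f x"
    and bound: "\<And>x. x \<in> V \<Longrightarrow> \<bar>f x\<bar> \<le> K * norm x"
  obtains G where "G \<in> V" "\<And>x. x \<in> V \<Longrightarrow> f x = inner G x"
proof -
  \<comment> \<open>The representing vector is the minimiser of \<open>q\<close> over
    \<open>V\<close>: along \<open>G + r x\<close> the derivative of \<open>q\<close> at
    \<open>r = 0\<close> is \<open>inner G x - f x\<close>.\<close>
  define q where "q x = (norm x)\<^sup>2 / 2 - f x" for x
  define m where "m = (INF x\<in>V. q x)"
  have "- K\<^sup>2 / 2 \<le> q x" if "x \<in> V" for x
    using bound[OF that] sum_squares_ge_zero[of "norm x - K" 0]
    unfolding q_def by (simp add: power2_eq_square field_simps)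
  then have bdd: "bdd_below (q ` V)"
    by (intro bdd_belowI) auto
  have ne: "V \<noteq> {}"
    using subspace_0[OF V(1)] by auto
  have m_le: "m \<le> q x" if "x \<in> V" for x
    unfolding m_def using bdd that by (rule cINF_lower)
  have "\<exists>x\<in>V. q x < m + 1 / Suc n" for n
  proof (rule ccontr)
    assume "\<not> ?thesis"
    then have "m + 1 / Suc n \<le> m"
      unfolding m_def using ne by (intro cINF_greatest) (auto simp: not_less m_def)
    then show False by simp
  qed
  then obtain v where vV: "\<And>n. v n \<in> V" and vq: "\<And>n. q (v n) < m + 1 / Suc n"
    by metis
  \<comment> \<open>Parallelogram law: at the midpoint, which lies in \<open>V\<close>, the linear
    part \<open>f\<close> just averages, so only the quadratic part remains. Near-minimisers are
    thus close to each other.\<close>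
  have par: "(norm (x - y))\<^sup>2 \<le> 4 * ((q x - m) + (q y - m))" if "x \<in> V" "y \<in> V" for x y
  proof -
    let ?z = "(1/2) *\<^sub>R (x + y)"
    have "?z \<in> V"
      using V(1) that by (intro subspace_scale subspace_add)
    then have "m \<le> q ?z" by (rule m_le)
    moreover have "f ?z = (f x + f y) / 2"
      using that V(1) by (simp add: scale add subspace_add)
    moreover have "(norm ?z)\<^sup>2 = (norm (x + y))\<^sup>2 / 4"
      by (simp add: power_divide)
    moreover have "(norm (x - y))\<^sup>2 + (norm (x + y))\<^sup>2 = 2 * (norm x)\<^sup>2 + 2 * (norm y)\<^sup>2"
      by (simp add: power2_norm_eq_inner inner_diff inner_add inner_commute)
    ultimately show ?thesis
      unfolding q_def by (simp add: field_simps)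
  qed
  have "Cauchy v"
  proof (rule metric_CauchyI)
    fix e :: real assume "e > 0"
    then obtain N where N: "1 / Suc N < e\<^sup>2 / 8"
      by (metis zero_less_power zero_less_divide_iff nat_approx_posE zero_less_numeral)
    show "\<exists>M. \<forall>i\<ge>M. \<forall>j\<ge>M. dist (v i) (v j) < e"
    proof (intro exI allI impI)
      fix i j assume "N \<le> i" "N \<le> j"
      then have "1 / Suc i \<le> 1 / Suc N" "1 / Suc j \<le> 1 / Suc N"
        by (auto simp: field_simps)
      then have "q (v i) - m < e\<^sup>2 / 8" "q (v j) - m < e\<^sup>2 / 8"
        using vq[of i] vq[of j] N by (simp_all only: diff_less_eq)
      with par[OF vV[of i] vV[of j]] have "(norm (v i - v j))\<^sup>2 < e\<^sup>2"
        by argo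
      then show "dist (v i) (v j) < e"
        using \<open>e > 0\<close> by (simp add: dist_norm power_less_imp_less_base)
    qed
  qed
  then obtain G where G: "v \<longlonglongrightarrow> G"
    using Cauchy_convergent convergent_def by blast
  have GV: "G \<in> V"
    using V(2) vV G closed_sequentially by blast
  have "(\<lambda>n. f (v n)) \<longlonglongrightarrow> f G"
  proof (rule Lim_transform2[OF tendsto_const])
    have "\<bar>f G - f (v n)\<bar> \<le> K * norm (G - v n)" for n
    proof -
      have "f G = f (G - v n) + f (v n)"
        using GV vV V(1) by (subst add[symmetric]) (auto intro: subspace_diff)
      then show ?thesis
        using bound[of "G - v n"] GV vV V(1) subspace_diff by fastforce
    qed
    then have le: "norm (f G - f (v n)) \<le> K * norm (G - v n)" for n
      by simp
    have "(\<lambda>n. K * norm (G - v n)) \<longlonglongrightarrow> K * norm (G - G)"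
      by (intro tendsto_mult tendsto_norm tendsto_diff tendsto_const G)
    then have "(\<lambda>n. K * norm (G - v n)) \<longlonglongrightarrow> 0"
      by simp
    then show "(\<lambda>n. f G - f (v n)) \<longlonglongrightarrow> 0"
      by (rule Lim_null_comparison[OF always_eventually[OF allI[OF le]]])
  qed
  then have "(\<lambda>n. q (v n)) \<longlonglongrightarrow> q G"
    unfolding q_def by (intro tendsto_diff tendsto_divide tendsto_power tendsto_norm tendsto_const G) auto
  moreover have "(\<lambda>n. m + 1 / Suc n) \<longlonglongrightarrow> m + 0"
    using LIMSEQ_Suc[OF lim_1_over_n] by (intro tendsto_intros) auto
  ultimately have "q G \<le> m + 0"
    by (rule LIMSEQ_le) (use vq less_imp_le in blast)
  then have min: "q G \<le> q x" if "x \<in> V" for x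
    using m_le[OF that] by simp
  have "f x = inner G x" if "x \<in> V" for x
  proof -
    define d where "d = f x - inner G x"
    \<comment> \<open>The optimal step along \<open>x\<close> would be
      \<open>d / (norm x)^2\<close>; the added 1 covers \<open>x = 0\<close> and still lowers
      \<open>q\<close> unless \<open>d = 0\<close>.\<close>
    define r where "r = d / ((norm x)\<^sup>2 + 1)"
    have "q G \<le> q (G + r *\<^sub>R x)"
      using that GV V(1) by (intro min subspace_add subspace_scale)
    moreover have "q (G + r *\<^sub>R x) = q G + r\<^sup>2 * (norm x)\<^sup>2 / 2 - r * d"
    proof -
      have "(norm (G + r *\<^sub>R x))\<^sup>2 = (norm G)\<^sup>2 + 2 * r * inner G x + r\<^sup>2 * (norm x)\<^sup>2"
        unfolding power2_norm_eq_inner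
        by (simp add: inner_add inner_commute[of x G] power2_eq_square algebra_simps)
      moreover have "f (G + r *\<^sub>R x) = f G + r * f x"
        using that GV V(1) by (simp add: add scale subspace_scale)
      ultimately show ?thesis
        unfolding q_def d_def by (simp add: field_simps)
    qed
    moreover have d: "d = r * ((norm x)\<^sup>2 + 1)"
    proof -
      have "(norm x)\<^sup>2 + 1 \<noteq> 0"
        by (simp add: add_nonneg_eq_0_iff)
      then show ?thesis unfolding r_def by simp
    qed
    ultimately have "r\<^sup>2 * ((norm x)\<^sup>2 / 2 + 1) \<le> 0"
      by (simp add: power2_eq_square algebra_simps)
    moreover have "(norm x)\<^sup>2 / 2 + 1 > 0"
      by (simp add: add_nonneg_pos)
    ultimately have "r\<^sup>2 \<le> 0"
      by (simp add: mult_le_0_iff)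
    then have "r = 0" by simp
    with d show ?thesis unfolding d_def by simp
  qed
  with GV that show ?thesis by blast
qed

text \<open>Representing \<open>inner x\<close> on \<open>V\<close> gives the orthogonal projection
  \<open>P\<close>. The residual \<open>x - P\<close> is orthogonal to \<open>V\<close>, by
  \<open>orth\<close> also to \<open>x\<close>, hence to itself. Membership in \<open>V\<close> can
  so be tested by scalar functionals.\<close>

lemma closed_subspace_if_orthogonal:
  fixes V :: "'a::{real_inner,banach} set"
  assumes V: "subspace V" "closed V"
    and orth: "\<And>w. (\<And>v. v \<in> V \<Longrightarrow> inner v w = 0) \<Longrightarrow> inner x w = 0"
  shows "x \<in> V"
proof -
  obtain P where P: "P \<in> V" "\<And>v. v \<in> V \<Longrightarrow> inner x v = inner P v"
  proof (rule Riesz_closed_subspace[OF V, of "inner x" "norm x"])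
    show "\<bar>inner x v\<bar> \<le> norm x * norm v" for v
      by (rule Cauchy_Schwarz_ineq2)
  qed (auto simp: inner_add_right)
  have "inner v (x - P) = 0" if "v \<in> V" for v
    using P(2)[OF that] by (simp add: inner_diff inner_commute)
  then have "inner x (x - P) = 0" "inner P (x - P) = 0"
    using orth P(1) by auto
  then have "inner (x - P) (x - P) = 0"
    by (simp add: inner_diff_left)
  then show ?thesis using P(1) by simp
qed

text \<open>Inner products with a fixed \<open>w\<close> pass through the integral, and for
  \<open>w\<close> orthogonal to \<open>V\<close> the scalar integrand vanishes. This carries
  adaptedness from a drift to its integral.\<close>

lemma integral_in_closed_subspace:
  fixes f :: "real \<Rightarrow> 'a::{real_inner,banach}"
  assumes V: "subspace V" "closed V" and f: "\<And>s. s \<in> A \<Longrightarrow> f s \<in> V"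
  shows "integral A f \<in> V"
proof (cases "f integrable_on A")
  case True
  show ?thesis
  proof (rule closed_subspace_if_orthogonal[OF V])
    fix w assume w: "\<And>v. v \<in> V \<Longrightarrow> inner v w = 0"
    have "((\<lambda>x. inner x w) \<circ> f has_integral inner (integral A f) w) A"
      using True by (intro has_integral_linear bounded_linear_inner_left) auto
    then have "((\<lambda>x. 0) has_integral inner (integral A f) w) A"
      by (rule has_integral_eq[rotated]) (auto simp: w f)
    then show "inner (integral A f) w = 0"
      using has_integral_0_eq by blast
  qed
next
  \<comment> \<open>A non-integrable function has integral 0 by convention, and 0 lies in
    \<open>V\<close>.\<close>
  case False
  then show ?thesis
    using V(1) by (simp add: not_integrable_integral subspace_0)
qed

lemma subspace_closure:
  fixes S :: "'a::real_normed_vector set"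
  assumes "subspace S"
  shows "subspace (closure S)"
  unfolding subspace_def
proof (intro conjI ballI allI)
  show "0 \<in> closure S"
    using assms closure_subset subspace_0 by blast
next
  fix x y assume "x \<in> closure S" "y \<in> closure S"
  then obtain u v where "\<forall>n. u n \<in> S" "u \<longlonglongrightarrow> x" "\<forall>n. v n \<in> S" "v \<longlonglongrightarrow> y"
    unfolding closure_sequential by blast
  then show "x + y \<in> closure S"
    unfolding closure_sequential using assms
    by (intro exI[of _ "\<lambda>n. u n + v n"]) (auto intro: tendsto_add subspace_add)
next
  fix x and c :: real assume "x \<in> closure S"
  then obtain u where "\<forall>n. u n \<in> S" "u \<longlonglongrightarrow> x"
    unfolding closure_sequential by blast
  then show "c *\<^sub>R x \<in> closure S"
    unfolding closure_sequential using assms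
    by (intro exI[of _ "\<lambda>n. c *\<^sub>R u n"]) (auto intro: tendsto_scaleR subspace_scale)
qed

text \<open>Serves to extend the adjoint from the image of \<open>M\<close> to all of L2. The map
  \<open>f\<close> is arbitrary off \<open>A\<close>; its Lipschitz bound on \<open>A\<close>
  produces the extension, and the identities pass to it along sequences from
  \<open>A\<close>.\<close>

lemma bounded_linear_extension:
  fixes A :: "'a::real_normed_vector set" and f :: "'a \<Rightarrow> 'b::banach"
  assumes A: "subspace A" "closure A = UNIV"
    and add: "\<And>x y. x \<in> A \<Longrightarrow> y \<in> A \<Longrightarrow> f (x + y) = f x + f y"
    and scale: "\<And>r x. x \<in> A \<Longrightarrow> f (r *\<^sub>R x) = r *\<^sub>R f x"
    and bound: "\<And>x. x \<in> A \<Longrightarrow> norm (f x) \<le> K * norm x"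
  obtains g where "bounded_linear g" "\<And>x. x \<in> A \<Longrightarrow> g x = f x"
proof -
  have diff: "f (x - y) = f x - f y" if "x \<in> A" "y \<in> A" for x y
    using add[of "x - y" y] that A(1) by (simp add: subspace_diff)
  have "\<bar>K\<bar>-lipschitz_on A f"
  proof (rule lipschitz_onI)
    fix x y assume "x \<in> A" "y \<in> A"
    then have "norm (f x - f y) \<le> K * norm (x - y)"
      using bound[of "x - y"] A(1) by (simp add: diff subspace_diff)
    also have "\<dots> \<le> \<bar>K\<bar> * norm (x - y)"
      by (intro mult_right_mono) auto
    finally show "dist (f x) (f y) \<le> \<bar>K\<bar> * dist x y"
      by (simp add: dist_norm)
  qed simp
  then have "uniformly_continuous_on A f"
    by (rule lipschitz_on_uniformly_continuous)
  then obtain g where g: "uniformly_continuous_on (closure A) g" "\<And>x. x \<in> A \<Longrightarrow> f x = g x"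
    using uniformly_continuous_on_extension_on_closure by metis
  then have cont: "isCont g x" for x
    using A(2) uniformly_continuous_imp_continuous[OF g(1)] by (simp add: continuous_on_eq_continuous_at)
  have seq: "\<exists>u. (\<forall>n. u n \<in> A) \<and> u \<longlonglongrightarrow> x" for x
    using A(2) by (metis UNIV_I closure_sequential)
  have "bounded_linear g"
  proof (rule bounded_linear_intro)
    fix x y
    obtain u v where u: "\<And>n. u n \<in> A" "u \<longlonglongrightarrow> x" and v: "\<And>n. v n \<in> A" "v \<longlonglongrightarrow> y"
      using seq[of x] seq[of y] by blast
    have "(\<lambda>n. g (u n + v n)) \<longlonglongrightarrow> g (x + y)"
      by (intro isCont_tendsto_compose[OF cont] tendsto_add u v)
    moreover have "g (u n + v n) = g (u n) + g (v n)" for n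
      using u(1) v(1) A(1) add g(2) by (metis subspace_add)
    ultimately have "(\<lambda>n. g (u n) + g (v n)) \<longlonglongrightarrow> g (x + y)" by simp
    moreover have "(\<lambda>n. g (u n) + g (v n)) \<longlonglongrightarrow> g x + g y"
      by (intro tendsto_add isCont_tendsto_compose[OF cont] u v)
    ultimately show "g (x + y) = g x + g y"
      using LIMSEQ_unique by blast
  next
    fix r :: real and x
    obtain u where u: "\<And>n. u n \<in> A" "u \<longlonglongrightarrow> x"
      using seq[of x] by blast
    have "(\<lambda>n. g (r *\<^sub>R u n)) \<longlonglongrightarrow> g (r *\<^sub>R x)"
      by (intro isCont_tendsto_compose[OF cont] tendsto_scaleR tendsto_const u)
    moreover have "g (r *\<^sub>R u n) = r *\<^sub>R g (u n)" for n
      using u(1) A(1) scale g(2) by (metis subspace_scale)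
    ultimately have "(\<lambda>n. r *\<^sub>R g (u n)) \<longlonglongrightarrow> g (r *\<^sub>R x)" by simp
    moreover have "(\<lambda>n. r *\<^sub>R g (u n)) \<longlonglongrightarrow> r *\<^sub>R g x"
      by (intro tendsto_scaleR tendsto_const isCont_tendsto_compose[OF cont] u)
    ultimately show "g (r *\<^sub>R x) = r *\<^sub>R g x"
      using LIMSEQ_unique by blast
  next
    fix x
    obtain u where u: "\<And>n. u n \<in> A" "u \<longlonglongrightarrow> x"
      using seq[of x] by blast
    have "norm (g (u n)) \<le> norm (u n) * K" for n
      using bound[OF u(1)] g(2)[OF u(1)] by (simp add: mult.commute)
    moreover have "(\<lambda>n. norm (g (u n))) \<longlonglongrightarrow> norm (g x)"
      by (intro tendsto_norm isCont_tendsto_compose[OF cont] u)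
    moreover have "(\<lambda>n. norm (u n) * K) \<longlonglongrightarrow> norm x * K"
      by (intro tendsto_mult tendsto_norm tendsto_const u)
    ultimately show "norm (g x) \<le> norm x * K"
      using LIMSEQ_le by blast
  qed
  with g(2) that show ?thesis by metis
qed


section \<open>Adjoints and von Neumann algebras\<close>

lemma cinner_add_left: "cinner (x + y) z = cinner x z + cinner y z"
  for x y z :: "'a::complex_hilbert"
  by (metis cinner_commute cinner_add_right complex_cnj_add)

lemma cinner_scaleR_right: "cinner x (r *\<^sub>R y) = of_real r * cinner x y"
  for x y :: "'a::complex_hilbert"
  by (metis scaleC_of_real cinner_scaleC_right)

lemma cinner_scaleR_left: "cinner (r *\<^sub>R x) y = of_real r * cinner x y"
  for x y :: "'a::complex_hilbert"
  by (metis cinner_commute cinner_scaleR_right complex_cnj_mult complex_cnj_complex_of_real)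

lemma cinner_zero_right [simp]: "cinner x 0 = 0"
  for x :: "'a::complex_hilbert"
  using cinner_add_right[of x 0 0] by simp

lemma scaleC_zero_right [simp]: "scaleC c (0::'a::complex_hilbert) = 0"
  using scaleC_add_right[of c 0 "0::'a"] by simp

lemma scaleC_scaleR: "scaleC c (r *\<^sub>R x) = r *\<^sub>R scaleC c x"
  for x :: "'a::complex_hilbert"
  by (metis scaleC_of_real scaleC_scaleC mult.commute)

lemma cinner_eqI:
  fixes x x' :: "'a::complex_hilbert"
  assumes "\<And>y. cinner x y = cinner x' y"
  shows "x = x'"
  using assms by (metis inner_eq_Re_cinner vector_eq_rdot)

text \<open>Multiplying the second argument by \<open>\<i>\<close> rotates the value, so the real
  inner product determines the complex one. This lifts the real Riesz theorem to complex
  adjoints.\<close>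

lemma Im_cinner: "Im (cinner x y) = - inner x (scaleC \<i> y)"
  for x y :: "'a::complex_hilbert"
  by (simp add: inner_eq_Re_cinner cinner_scaleC_right)

lemma adj_eqI:
  fixes a b :: "'h::complex_hilbert \<Rightarrow>\<^sub>L 'h"
  assumes "\<And>x y. cinner (b x) y = cinner x (a y)"
  shows "adj a = b"
  unfolding adj_def
proof (rule the_equality)
  show "\<forall>x y. cinner (b x) y = cinner x (a y)" using assms by simp
  show "b' = b" if "\<forall>x y. cinner (blinfun_apply b' x) y = cinner x (a y)" for b'
    using that assms by (intro blinfun_eqI cinner_eqI) simp
qed

text \<open>As \<open>adj\<close> is a definite description, an adjoint has to be constructed: Riesz
  represents \<open>inner x (a y)\<close> as a functional of \<open>y\<close>, and
  \<open>adj_eqI\<close> identifies the resulting operator.\<close>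

lemma cinner_adj:
  fixes a :: "'h::complex_hilbert \<Rightarrow>\<^sub>L 'h"
  assumes a: "a \<in> clinear_ops"
  shows "cinner (adj a x) y = cinner x (a y)"
proof -
  have "\<exists>z. \<forall>y. inner x (a y) = inner z y" for x
  proof -
    obtain z where "\<And>y. y \<in> UNIV \<Longrightarrow> inner x (a y) = inner z y"
    proof (rule Riesz_closed_subspace[of UNIV "\<lambda>y. inner x (a y)" "norm x * norm a"])
      fix y
      have "\<bar>inner x (a y)\<bar> \<le> norm x * norm (a y)"
        by (rule Cauchy_Schwarz_ineq2)
      also have "\<dots> \<le> norm x * (norm a * norm y)"
        by (intro mult_left_mono norm_blinfun) auto
      finally show "\<bar>inner x (a y)\<bar> \<le> norm x * norm a * norm y"
        by (simp add: mult.assoc)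
    qed (auto simp: blinfun.add_right blinfun.scaleR_right inner_add_right)
    then show ?thesis by auto
  qed
  then obtain b where b: "\<And>x y. inner x (a y) = inner (b x) y"
    by metis
  have "bounded_linear b"
  proof (rule bounded_linear_intro)
    show "b (x + y) = b x + b y" for x y
      by (rule vector_eq_rdot[THEN iffD1]) (simp add: b[symmetric] inner_add_left)
    show "b (r *\<^sub>R x) = r *\<^sub>R b x" for r x
      by (rule vector_eq_rdot[THEN iffD1]) (simp add: b[symmetric])
    show "norm (b x) \<le> norm x * norm a" for x
    proof (cases "b x = 0")
      case False
      have "norm (b x) * norm (b x) = inner x (a (b x))"
        by (simp add: b power2_norm_eq_inner[symmetric] power2_eq_square)
      also have "\<dots> \<le> norm x * norm (a (b x))"
        by (rule norm_cauchy_schwarz)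
      also have "\<dots> \<le> norm x * (norm a * norm (b x))"
        by (intro mult_left_mono norm_blinfun) auto
      finally show ?thesis using False by simp
    qed simp
  qed
  then have [simp]: "blinfun_apply (Blinfun b) = b"
    by (rule bounded_linear_Blinfun_apply)
  have "cinner (Blinfun b x) y = cinner x (a y)" for x y
  proof (rule complex_eqI)
    show "Re (cinner (Blinfun b x) y) = Re (cinner x (a y))"
      by (simp add: inner_eq_Re_cinner[symmetric] b)
    \<comment> \<open>Complex linearity of \<open>a\<close> enters here: \<open>a\<close> commutes
      with \<open>\<i>\<close>, so the imaginary parts are the real identity taken at
      \<open>scaleC \<i> y\<close>.\<close>
    show "Im (cinner (Blinfun b x) y) = Im (cinner x (a y))"
      using a b[of x "scaleC \<i> y"] by (simp add: Im_cinner clinear_ops_def)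
  qed
  then show ?thesis using adj_eqI[of "Blinfun b" a] by metis
qed

lemma adj_add:
  assumes "a \<in> clinear_ops" "b \<in> clinear_ops"
  shows "adj (a + b) = adj a + adj b"
  using assms
  by (intro adj_eqI) (simp add: blinfun.add_left cinner_add_left cinner_add_right cinner_adj)

lemma adj_scaleR:
  assumes "a \<in> clinear_ops"
  shows "adj (r *\<^sub>R a) = r *\<^sub>R adj a"
  using assms
  by (intro adj_eqI) (simp add: blinfun.scaleR_left cinner_scaleR_left cinner_scaleR_right cinner_adj)

lemma adj_adj:
  assumes "a \<in> clinear_ops"
  shows "adj (adj a) = a"
  by (intro adj_eqI) (metis assms cinner_adj cinner_commute)

text \<open>Commuting with a set of operators and with complex scalars are linear conditions. A von
  Neumann algebra, being its own double commutant, gets from here the linear structure that its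
  definition does not list.\<close>

lemma subspace_commutant: "subspace (commutant A)"
proof -
  have comm: "a o\<^sub>L b = b o\<^sub>L a \<longleftrightarrow> (\<forall>x. a (b x) = b (a x))" for a b :: "'a \<Rightarrow>\<^sub>L 'a"
    by (metis blinfun_apply_blinfun_compose blinfun_eqI)
  show ?thesis
    unfolding subspace_def commutant_def clinear_ops_def comm
    by (simp add: blinfun.add_left blinfun.add_right blinfun.scaleR_left
        blinfun.scaleR_right scaleC_add_right scaleC_scaleR)
qed

lemma subspace_von_neumann_algebra: "von_neumann_algebra A \<Longrightarrow> subspace A"
  unfolding von_neumann_algebra_def by (metis subspace_commutant)

lemma cscale_op_of_real: "cscale_op (of_real r) a = r *\<^sub>R a"
  by (simp add: cscale_op_def scaleC_of_real blinfun_apply_inverse flip: blinfun.scaleR_left)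

text \<open>The exact value is \<open>v\<close>; the factor 4 saves computing the integral. On the
  support \<open>x^2 \<le> 4 * v\<close>, and the density has mass 1 because its zeroth moment is
  \<open>\<tau> id_blinfun\<close>.\<close>

lemma semicircular_second_moment_le:
  assumes "semicircular \<tau> v d" "v > 0" "\<tau> id_blinfun = 1"
  shows "Re (\<tau> (adj d o\<^sub>L d)) \<le> 4 * v"
proof -
  define w where "w x = sqrt (4 * v - x\<^sup>2) / (2 * pi * v)" for x
  define I where "I = {- 2 * sqrt v .. 2 * sqrt v}"
  have moment: "\<tau> (pow_op d n) = of_real (integral I (\<lambda>x. x ^ n * w x))" for n
    using assms(1) by (simp add: semicircular_def w_def I_def)
  have "adj d o\<^sub>L d = pow_op d 2"
    using assms(1) by (auto simp: semicircular_def pow_op_def numeral_2_eq_2 intro: blinfun_eqI)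
  then have 2: "Re (\<tau> (adj d o\<^sub>L d)) = integral I (\<lambda>x. x\<^sup>2 * w x)"
    by (simp add: moment)
  have "integral I w = 1"
    using moment[of 0] assms(3) by (simp add: pow_op_def flip: of_real_eq_iff)
  have cont: "continuous_on I w"
    unfolding w_def using assms(2) by (intro continuous_intros) auto
  have sq: "x\<^sup>2 \<le> 4 * v" if "x \<in> I" for x
  proof -
    have "\<bar>x\<bar> \<le> 2 * sqrt v"
      using that by (auto simp: I_def)
    then have "\<bar>x\<bar>\<^sup>2 \<le> (2 * sqrt v)\<^sup>2"
      by (intro power_mono) auto
    then show ?thesis
      using assms(2) by (simp add: power_mult_distrib)
  qed
  have "integral I (\<lambda>x. x\<^sup>2 * w x) \<le> integral I (\<lambda>x. 4 * v * w x)"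
  proof (rule integral_le)
    show "(\<lambda>x. x\<^sup>2 * w x) integrable_on I" "(\<lambda>x. 4 * v * w x) integrable_on I"
      using cont unfolding I_def by (auto intro!: integrable_continuous_interval continuous_intros)
    show "x\<^sup>2 * w x \<le> 4 * v * w x" if "x \<in> I" for x
      using sq[OF that] assms(2) by (intro mult_right_mono) (auto simp: w_def)
  qed
  also have "\<dots> = 4 * v"
    using \<open>integral I w = 1\<close> by simp
  finally show ?thesis by (simp add: 2)
qed

section \<open>The space \<open>L\<^sup>2(M, \<tau>)\<close>\<close>

text \<open>Shows that the description defining \<open>L2_star\<close> is met exactly once.
  Faithfulness of the trace makes \<open>\<iota>\<close> injective, so the adjoint is well defined
  on the image; traciality makes it isometric there; density gives the extension and its
  uniqueness.\<close>

lemma L2_star: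
  fixes M :: "('h::complex_hilbert \<Rightarrow>\<^sub>L 'h) set"
    and \<iota> :: "('h \<Rightarrow>\<^sub>L 'h) \<Rightarrow> 'l::complex_hilbert"
  assumes M: "tracial_von_neumann_algebra M \<tau>" and L2: "L2_completion M \<tau> \<iota>"
  shows "bounded_linear (L2_star M \<iota>)" "\<And>a. a \<in> M \<Longrightarrow> L2_star M \<iota> (\<iota> a) = \<iota> (adj a)"
proof -
  have M': "M \<subseteq> clinear_ops" "\<And>a. a \<in> M \<Longrightarrow> adj a \<in> M" "subspace M"
    using M subspace_von_neumann_algebra
    by (auto simp: tracial_von_neumann_algebra_def von_neumann_algebra_def)
  have \<iota>_add: "\<iota> (a + b) = \<iota> a + \<iota> b" if "a \<in> M" "b \<in> M" for a b
    using L2 that by (simp add: L2_completion_def)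
  have \<iota>_scale: "\<iota> (r *\<^sub>R a) = r *\<^sub>R \<iota> a" if "a \<in> M" for r a
    using L2 that unfolding L2_completion_def
    by (metis cscale_op_of_real scaleC_of_real)
  have \<iota>_cinner: "cinner (\<iota> a) (\<iota> b) = \<tau> (adj a o\<^sub>L b)" if "a \<in> M" "b \<in> M" for a b
    using L2 that by (simp add: L2_completion_def)
  have norm_adj: "norm (\<iota> (adj a)) = norm (\<iota> a)" if "a \<in> M" for a
  proof -
    have "cinner (\<iota> (adj a)) (\<iota> (adj a)) = \<tau> (a o\<^sub>L adj a)"
      using that M' by (subst \<iota>_cinner) (auto simp: adj_adj subset_iff)
    also have "\<dots> = \<tau> (adj a o\<^sub>L a)"
      using M M'(2) that by (simp add: tracial_von_neumann_algebra_def)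
    also have "\<dots> = cinner (\<iota> a) (\<iota> a)"
      using that by (simp add: \<iota>_cinner)
    finally show ?thesis
      by (simp add: norm_eq_sqrt_inner inner_eq_Re_cinner)
  qed
  have inj: "inj_on \<iota> M"
  proof (rule inj_onI)
    fix a b assume ab: "a \<in> M" "b \<in> M" "\<iota> a = \<iota> b"
    have "\<iota> (a - b) = \<iota> a - \<iota> b"
      using ab M'(3) \<iota>_add[of "a - b" b] by (simp add: subspace_diff)
    then have "\<tau> (adj (a - b) o\<^sub>L (a - b)) = 0"
      using ab M'(3) \<iota>_cinner[of "a - b" "a - b"] by (simp add: subspace_diff)
    moreover have "\<forall>a\<in>M. \<tau> (adj a o\<^sub>L a) = 0 \<longrightarrow> a = 0"
      using M unfolding tracial_von_neumann_algebra_def by blast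
    moreover have "a - b \<in> M"
      using ab M'(3) by (simp add: subspace_diff)
    ultimately have "a - b = 0" by blast
    then show "a = b" by simp
  qed
  define f where "f y = \<iota> (adj (inv_into M \<iota> y))" for y
  have f: "f (\<iota> a) = \<iota> (adj a)" if "a \<in> M" for a
    using that inj by (simp add: f_def)
  have sub: "subspace (\<iota> ` M)"
    unfolding subspace_def
  proof (intro conjI ballI allI)
    have "\<iota> 0 = 0"
      using \<iota>_scale[of 0 0] M'(3) by (simp add: subspace_0)
    then show "0 \<in> \<iota> ` M"
      using M'(3) subspace_0 by (metis image_eqI)
  next
    fix x y assume "x \<in> \<iota> ` M" "y \<in> \<iota> ` M"
    then show "x + y \<in> \<iota> ` M"
      using M'(3) by (auto simp: \<iota>_add[symmetric] intro: subspace_add)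
  next
    fix x and c :: real assume "x \<in> \<iota> ` M"
    then show "c *\<^sub>R x \<in> \<iota> ` M"
      using M'(3) by (auto simp: \<iota>_scale[symmetric] intro: subspace_scale)
  qed
  have dense: "closure (\<iota> ` M) = UNIV"
    using L2 by (simp add: L2_completion_def)
  obtain J where J: "bounded_linear J" "\<And>x. x \<in> \<iota> ` M \<Longrightarrow> J x = f x"
  proof (rule bounded_linear_extension[OF sub dense, of f 1])
    fix x y assume "x \<in> \<iota> ` M" "y \<in> \<iota> ` M"
    then obtain a b where ab: "a \<in> M" "b \<in> M" "x = \<iota> a" "y = \<iota> b" by blast
    then have "f (x + y) = \<iota> (adj (a + b))"
      using M'(3) by (simp add: \<iota>_add[symmetric] f subspace_add)
    also have "adj (a + b) = adj a + adj b"
      using ab M'(1) by (intro adj_add) auto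
    finally show "f (x + y) = f x + f y"
      using ab M'(2) by (simp add: f \<iota>_add)
  next
    fix r x assume "x \<in> \<iota> ` M"
    then obtain a where a: "a \<in> M" "x = \<iota> a" by blast
    then have "f (r *\<^sub>R x) = \<iota> (adj (r *\<^sub>R a))"
      using M'(3) by (simp add: \<iota>_scale[symmetric] f subspace_scale)
    also have "adj (r *\<^sub>R a) = r *\<^sub>R adj a"
      using a M'(1) by (intro adj_scaleR) auto
    finally show "f (r *\<^sub>R x) = r *\<^sub>R f x"
      using a M'(2) by (simp add: f \<iota>_scale)
  next
    fix x assume "x \<in> \<iota> ` M"
    then show "norm (f x) \<le> 1 * norm x"
      by (auto simp: f norm_adj)
  qed blast
  have ex1: "\<exists>!J. bounded_linear J \<and> (\<forall>a\<in>M. J (\<iota> a) = \<iota> (adj a))"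
  proof (rule ex1I[of _ J])
    show "bounded_linear J \<and> (\<forall>a\<in>M. J (\<iota> a) = \<iota> (adj a))"
      using J by (auto simp: f)
    fix J' assume J': "bounded_linear J' \<and> (\<forall>a\<in>M. J' (\<iota> a) = \<iota> (adj a))"
    have "closed {x. J' x = J x}"
      using J' J(1) by (intro closed_Collect_eq) (auto simp: linear_continuous_on)
    moreover have "\<iota> ` M \<subseteq> {x. J' x = J x}"
      using J' J(2) by (auto simp: f)
    ultimately have "closure (\<iota> ` M) \<subseteq> {x. J' x = J x}"
      by (rule closure_minimal[rotated])
    then show "J' = J"
      using dense by auto
  qed
  show "bounded_linear (L2_star M \<iota>)" "\<And>a. a \<in> M \<Longrightarrow> L2_star M \<iota> (\<iota> a) = \<iota> (adj a)"
    using theI'[OF ex1] unfolding L2_star_def by blast+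
qed

lemma L2_embedding_diff:
  assumes "tracial_von_neumann_algebra M \<tau>" "L2_completion M \<tau> \<iota>" "a \<in> M" "b \<in> M"
  shows "\<iota> (a - b) = \<iota> a - \<iota> b"
proof -
  have "a - b \<in> M"
    using assms subspace_von_neumann_algebra
    by (auto simp: tracial_von_neumann_algebra_def intro: subspace_diff)
  then have "\<iota> ((a - b) + b) = \<iota> (a - b) + \<iota> b"
    using assms by (simp only: L2_completion_def)
  then show ?thesis by simp
qed

text \<open>\<open>L2_sa\<close> is the intersection of a closure with the fixed points of the
  bounded star. The star is conjugate linear, so only real scalars preserve these fixed points;
  hence real Hilbert spaces throughout what follows.\<close>

lemma L2_sa_vec_subspace_closed:
  fixes M :: "('h::complex_hilbert \<Rightarrow>\<^sub>L 'h) set"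
    and \<iota> :: "('h \<Rightarrow>\<^sub>L 'h) \<Rightarrow> 'l::complex_hilbert"
  assumes M: "tracial_von_neumann_algebra M \<tau>" and L2: "L2_completion M \<tau> \<iota>"
    and A: "von_neumann_algebra A" "A \<subseteq> M"
  shows "subspace (L2_sa_vec M \<iota> A :: ('l ^ 'm::finite) set)"
    and "closed (L2_sa_vec M \<iota> A :: ('l ^ 'm) set)"
proof -
  let ?J = "L2_star M \<iota>"
  note J = L2_star[OF M L2]
  have subA: "subspace A"
    using A(1) by (rule subspace_von_neumann_algebra)
  have "subspace (\<iota> ` A)"
    unfolding subspace_def
  proof (intro conjI ballI allI)
    have "\<iota> (0 - 0) = \<iota> 0 - \<iota> 0"
      using A(2) subspace_0[OF subA] by (intro L2_embedding_diff[OF M L2]) auto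
    then have "0 = \<iota> 0" by simp
    then show "0 \<in> \<iota> ` A"
      using subspace_0[OF subA] by blast
  next
    fix x y assume "x \<in> \<iota> ` A" "y \<in> \<iota> ` A"
    then obtain a b where ab: "a \<in> A" "b \<in> A" "x = \<iota> a" "y = \<iota> b" by blast
    then have "x + y = \<iota> (a + b)"
      using A(2) L2 unfolding L2_completion_def by (metis subsetD)
    then show "x + y \<in> \<iota> ` A"
      using ab subA by (auto intro: subspace_add)
  next
    fix x and r :: real assume "x \<in> \<iota> ` A"
    then obtain a where a: "a \<in> A" "x = \<iota> a" by blast
    then have "r *\<^sub>R x = \<iota> (r *\<^sub>R a)"
      using A(2) L2 unfolding L2_completion_def by (metis cscale_op_of_real scaleC_of_real subsetD)
    then show "r *\<^sub>R x \<in> \<iota> ` A"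
      using a subA by (auto intro: subspace_scale)
  qed
  then have "subspace (closure (\<iota> ` A))"
    by (rule subspace_closure)
  moreover have "subspace {x. ?J x = x}"
    using J(1) unfolding subspace_def
    by (auto simp: linear_simps dest: bounded_linear.linear)
  moreover have eq: "L2_sa M \<iota> A = closure (\<iota> ` A) \<inter> {x. ?J x = x}"
    by (auto simp: L2_sa_def)
  ultimately have sub: "subspace (L2_sa M \<iota> A)"
    by (simp add: subspace_inter)
  then show "subspace (L2_sa_vec M \<iota> A :: ('l ^ 'm) set)"
    unfolding L2_sa_vec_def subspace_def by auto
  have "closed {x. ?J x = x}"
    using J(1) by (intro closed_Collect_eq) (auto simp: linear_continuous_on)
  then have cl: "closed (L2_sa M \<iota> A)"
    unfolding eq by (intro closed_Int) auto
  have "L2_sa_vec M \<iota> A = (\<Inter>j::'m. (\<lambda>X. X $ j) -` L2_sa M \<iota> A)"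
    by (auto simp: L2_sa_vec_def)
  moreover have "closed ((\<lambda>X. X $ j) -` L2_sa M \<iota> A)" for j :: 'm
    by (intro closed_vimage cl continuous_intros)
  ultimately show "closed (L2_sa_vec M \<iota> A :: ('l ^ 'm) set)"
    by auto
qed

lemma L2_sa_vec_mono: "A \<subseteq> B \<Longrightarrow> L2_sa_vec M \<iota> A \<subseteq> L2_sa_vec M \<iota> B"
  unfolding L2_sa_vec_def L2_sa_def using closure_mono[of "\<iota> ` A" "\<iota> ` B"] by blast

lemma L2_vec_in_L2_sa_vec:
  assumes M: "tracial_von_neumann_algebra M \<tau>" and L2: "L2_completion M \<tau> \<iota>"
    and A: "A \<subseteq> M" "\<And>j. a j \<in> self_adjoint_part A"
  shows "L2_vec \<iota> a \<in> L2_sa_vec M \<iota> A"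
proof -
  have "\<iota> (a j) \<in> closure (\<iota> ` A)" "L2_star M \<iota> (\<iota> (a j)) = \<iota> (a j)" for j
    using A(2)[of j] A(1) L2_star(2)[OF M L2, of "a j"]
    by (auto simp: self_adjoint_part_def intro: subsetD[OF closure_subset])
  then show ?thesis
    by (simp add: L2_vec_def L2_sa_vec_def L2_sa_def)
qed

text \<open>Each component is Hoelder of exponent 1/2: an increment is semicircular of variance
  \<open>t - s\<close>, so its L2 norm is at most \<open>2 * sqrt (t - s)\<close>.\<close>

lemma continuous_on_free_Brownian_motion:
  fixes M :: "('h::complex_hilbert \<Rightarrow>\<^sub>L 'h) set"
    and \<iota> :: "('h \<Rightarrow>\<^sub>L 'h) \<Rightarrow> 'l::complex_hilbert"
    and S :: "real \<Rightarrow> 'm::finite \<Rightarrow> ('h \<Rightarrow>\<^sub>L 'h)"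
  assumes M: "tracial_von_neumann_algebra M \<tau>" and L2: "L2_completion M \<tau> \<iota>"
    and filtration: "vn_filtration M Mt"
    and brownian: "adapted_free_brownian_motion \<tau> Mt S"
  shows "continuous_on {0..} (\<lambda>t. L2_vec \<iota> (S t))"
  unfolding L2_vec_def
proof (rule continuous_on_vec_lambda)
  fix j
  have S: "S t j \<in> M" if "t \<ge> 0" for t
  proof -
    have "S t j \<in> self_adjoint_part (Mt t)" "Mt t \<subseteq> M"
      using filtration brownian that
      unfolding vn_filtration_def adapted_free_brownian_motion_def by blast+
    then show ?thesis
      by (auto simp: self_adjoint_part_def)
  qed
  have less: "norm (\<iota> (S t j) - \<iota> (S s j)) \<le> 2 * sqrt (t - s)" if "0 \<le> s" "s < t" for s t
  proof -
    let ?d = "S t j - S s j"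
    have "subspace M"
      using M by (simp add: tracial_von_neumann_algebra_def subspace_von_neumann_algebra)
    then have d: "?d \<in> M"
      by (rule subspace_diff) (use that in \<open>simp_all add: S\<close>)
    have "(norm (\<iota> ?d))\<^sup>2 = Re (\<tau> (adj ?d o\<^sub>L ?d))"
      using d L2 by (simp add: L2_completion_def power2_norm_eq_inner inner_eq_Re_cinner)
    also have "\<dots> \<le> 4 * (t - s)"
      using brownian M that
      by (intro semicircular_second_moment_le)
        (auto simp: adapted_free_brownian_motion_def tracial_von_neumann_algebra_def)
    finally have "norm (\<iota> ?d) \<le> sqrt (4 * (t - s))"
      by (rule real_le_rsqrt)
    also have "sqrt (4 * (t - s)) = 2 * sqrt (t - s)"
      by (simp only: real_sqrt_mult real_sqrt_four)
    finally show ?thesis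
      using S that by (simp add: L2_embedding_diff[OF M L2])
  qed
  have le: "norm (\<iota> (S t j) - \<iota> (S s j)) \<le> 2 * sqrt \<bar>t - s\<bar>" if "0 \<le> s" "0 \<le> t" for s t
    using less[of s t] less[of t s] that by (cases s t rule: linorder_cases) (auto simp: norm_minus_commute)
  show "continuous_on {0..} (\<lambda>t. \<iota> (S t j))"
    unfolding continuous_on_def
  proof
    fix s :: real assume s: "s \<in> {0..}"
    have "((\<lambda>t. 2 * sqrt \<bar>t - s\<bar>) \<longlongrightarrow> 2 * sqrt \<bar>s - s\<bar>) (at s within {0..})"
      by (intro tendsto_mult tendsto_const tendsto_real_sqrt tendsto_rabs tendsto_diff tendsto_ident_at)
    then have lim: "((\<lambda>t. 2 * sqrt \<bar>t - s\<bar>) \<longlongrightarrow> 0) (at s within {0..})"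
      by simp
    have "eventually (\<lambda>t. norm (\<iota> (S t j) - \<iota> (S s j)) \<le> 2 * sqrt \<bar>t - s\<bar>) (at s within {0..})"
      unfolding eventually_at_filter using le s by (intro always_eventually) simp
    then have "((\<lambda>t. \<iota> (S t j) - \<iota> (S s j)) \<longlongrightarrow> 0) (at s within {0..})"
      using lim by (rule Lim_null_comparison)
    then show "((\<lambda>t. \<iota> (S t j)) \<longlongrightarrow> \<iota> (S s j)) (at s within {0..})"
      by (simp add: LIM_zero_iff)
  qed
qed

section \<open>Evolution equations with a monotone drift\<close>

text \<open>The equation on one grid interval after the past is frozen. \<open>G\<close> is
  normalised to 0 at the endpoints. \<open>G_uniform\<close> takes the earlier state in
  \<open>V s\<close> and the later one in \<open>V t\<close>, which is exactly what two values of an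
  adapted path provide.\<close>

locale monotone_evolution =
  fixes V :: "real \<Rightarrow> 'v::{real_inner,banach} set" and G :: "real \<Rightarrow> 'v \<Rightarrow> 'v"
    and S :: "real \<Rightarrow> 'v" and x\<^sub>0 :: 'v and a b L K :: real
  assumes ab: "a < b" and L: "L \<ge> 0" and K: "K \<ge> 0"
    and V_subspace: "\<And>t. t \<in> {a..b} \<Longrightarrow> subspace (V t)"
    and V_closed: "\<And>t. t \<in> {a..b} \<Longrightarrow> closed (V t)"
    and V_mono: "\<And>s t. a \<le> s \<Longrightarrow> s \<le> t \<Longrightarrow> t \<le> b \<Longrightarrow> V s \<subseteq> V t"
    and G_endpoints: "\<And>s x. s \<notin> {a<..<b} \<Longrightarrow> G s x = 0"
    and G_in: "\<And>s x. s \<in> {a<..<b} \<Longrightarrow> x \<in> V s \<Longrightarrow> G s x \<in> V s"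
    and G_growth: "\<And>s x. s \<in> {a<..<b} \<Longrightarrow> x \<in> V s \<Longrightarrow> norm (G s x) \<le> K * (1 + norm x)"
    and G_monotone: "\<And>s x y. s \<in> {a<..<b} \<Longrightarrow> x \<in> V s \<Longrightarrow> y \<in> V s
      \<Longrightarrow> inner (x - y) (G s x - G s y) \<ge> 0"
    and G_uniform: "\<And>R \<epsilon>. \<epsilon> > 0 \<Longrightarrow> \<exists>\<delta>>0. \<forall>s t x y. a < s \<and> s \<le> t \<and> t < b \<and> x \<in> V s \<and> y \<in> V t
      \<and> norm x \<le> R \<and> norm y \<le> R \<and> t - s < \<delta> \<and> norm (x - y) < \<delta> \<longrightarrow> norm (G s x - G t y) < \<epsilon>"
    and S_continuous: "continuous_on {a..b} S"
    and S_in: "\<And>t. t \<in> {a..b} \<Longrightarrow> S t - S a \<in> V t"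
    and x\<^sub>0: "x\<^sub>0 \<in> V a"
begin

definition adapted_path :: "(real \<Rightarrow> 'v) \<Rightarrow> bool" where
  "adapted_path x \<longleftrightarrow> continuous_on {a..b} x \<and> (\<forall>t\<in>{a..b}. x t \<in> V t)"

definition field :: "(real \<Rightarrow> 'v) \<Rightarrow> real \<Rightarrow> 'v" where
  "field x s = L *\<^sub>R x s - G s (x s)"

definition evolve :: "(real \<Rightarrow> 'v) \<Rightarrow> real \<Rightarrow> 'v" where
  "evolve x t = x\<^sub>0 + (S t - S a) + integral {a..t} (field x)"

text \<open>Up to time \<open>a + \<delta>\<close> the delayed path rests at its initial value. Only
  the state is delayed: \<open>field (delay \<delta> x) s\<close> still uses \<open>G\<close> at the
  current time \<open>s\<close>.\<close>

definition delay :: "real \<Rightarrow> (real \<Rightarrow> 'v) \<Rightarrow> real \<Rightarrow> 'v" where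
  "delay \<delta> x s = x (max a (s - \<delta>))"

section \<open>Integrability and adaptedness of the drift along a path\<close>

lemma adapted_path_bounded:
  assumes "adapted_path x"
  obtains R where "R > 0" "\<And>t. t \<in> {a..b} \<Longrightarrow> norm (x t) \<le> R"
proof -
  have "bounded (x ` {a..b})"
    using assms by (intro compact_imp_bounded compact_continuous_image) (auto simp: adapted_path_def)
  then show ?thesis
    using that by (auto simp: bounded_pos)
qed

text \<open>\<open>G_uniform\<close> is applied at the radius of the path, finite by compactness.
  Uniform continuity on the open interval, unlike plain continuity, yields limits at both ends and
  so integrability on the closed one.\<close>

lemma drift_uniformly_continuous:
  assumes x: "adapted_path x"
  shows "uniformly_continuous_on {a<..<b} (\<lambda>s. G s (x s))"
  unfolding uniformly_continuous_on_def
proof (intro allI impI)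
  fix \<epsilon> :: real assume "\<epsilon> > 0"
  obtain R where R: "\<And>t. t \<in> {a..b} \<Longrightarrow> norm (x t) \<le> R"
    using adapted_path_bounded[OF x] by blast
  obtain \<delta> where \<delta>: "\<delta> > 0" and close: "\<And>s t x y. a < s \<Longrightarrow> s \<le> t \<Longrightarrow> t < b \<Longrightarrow> x \<in> V s \<Longrightarrow> y \<in> V t
      \<Longrightarrow> norm x \<le> R \<Longrightarrow> norm y \<le> R \<Longrightarrow> t - s < \<delta> \<Longrightarrow> norm (x - y) < \<delta> \<Longrightarrow> norm (G s x - G t y) < \<epsilon>"
    using G_uniform[OF \<open>\<epsilon> > 0\<close>, of R] by blast
  have "uniformly_continuous_on {a..b} x"
    using x by (intro compact_uniformly_continuous) (auto simp: adapted_path_def)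
  then obtain \<delta>' where \<delta>': "\<delta>' > 0"
    "\<And>s t. s \<in> {a..b} \<Longrightarrow> t \<in> {a..b} \<Longrightarrow> dist t s < \<delta>' \<Longrightarrow> dist (x t) (x s) < \<delta>"
    using \<delta> by (rule uniformly_continuous_onE) blast
  have main: "norm (G s (x s) - G t (x t)) < \<epsilon>"
    if "a < s" "s \<le> t" "t < b" "t - s < min \<delta> \<delta>'" for s t
    using that R \<delta>'(2)[of s t] x
    by (intro close) (auto simp: adapted_path_def dist_norm norm_minus_commute)
  show "\<exists>d>0. \<forall>s\<in>{a<..<b}. \<forall>t\<in>{a<..<b}. dist t s < d \<longrightarrow> dist (G t (x t)) (G s (x s)) < \<epsilon>"
  proof (intro exI[of _ "min \<delta> \<delta>'"] conjI ballI impI)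
    show "0 < min \<delta> \<delta>'" using \<delta> \<delta>' by simp
    fix s t assume "s \<in> {a<..<b}" "t \<in> {a<..<b}" "dist t s < min \<delta> \<delta>'"
    then show "dist (G t (x t)) (G s (x s)) < \<epsilon>"
      using main[of s t] main[of t s]
      by (cases s t rule: le_cases) (auto simp: dist_norm norm_minus_commute)
  qed
qed

lemma field_integrable:
  assumes x: "adapted_path x" and t: "t \<le> b"
  shows "field x integrable_on {a..t}"
proof -
  \<comment> \<open>\<open>g\<close> extends the drift continuously to the closed interval and can
    differ from it there only at \<open>a\<close> and \<open>b\<close>.\<close>
  obtain g where g: "uniformly_continuous_on (closure {a<..<b}) g"
    "\<And>s. s \<in> {a<..<b} \<Longrightarrow> G s (x s) = g s"
    using uniformly_continuous_on_extension_on_closure[OF drift_uniformly_continuous[OF x]] by metis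
  have "continuous_on {a..b} (\<lambda>s. L *\<^sub>R x s - g s)"
    using uniformly_continuous_imp_continuous[OF g(1)] ab x
    by (intro continuous_intros) (auto simp: adapted_path_def)
  then have "(\<lambda>s. L *\<^sub>R x s - g s) integrable_on {a..b}"
    by (rule integrable_continuous_interval)
  then have "field x integrable_on {a..b}"
    by (rule integrable_spike_finite[rotated 2, of _ _ "{a, b}"]) (auto simp: field_def g(2))
  then show ?thesis
    by (rule integrable_on_subinterval) (use t in auto)
qed

lemma field_continuous:
  assumes x: "adapted_path x"
  shows "continuous_on {a<..<b} (field x)"
  unfolding field_def using x uniformly_continuous_imp_continuous[OF drift_uniformly_continuous[OF x]]
  by (intro continuous_intros) (auto simp: adapted_path_def intro: continuous_on_subset)

text \<open>Since the spaces increase, all values of the field up to time \<open>t\<close> lie in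
  the single closed subspace \<open>V t\<close>, and so does their integral.\<close>

lemma adapted_path_evolve:
  assumes x: "adapted_path x"
  shows "adapted_path (evolve x)"
  unfolding adapted_path_def
proof (intro conjI ballI)
  show "continuous_on {a..b} (evolve x)"
    unfolding evolve_def
    by (intro continuous_intros S_continuous indefinite_integral_continuous_1 field_integrable[OF x]) simp
  fix t assume t: "t \<in> {a..b}"
  have "field x s \<in> V t" if "s \<in> {a..t}" for s
  proof -
    have "x s \<in> V s" "V s \<subseteq> V t"
      using x that t V_mono[of s t] by (auto simp: adapted_path_def)
    moreover have "G s (x s) \<in> V t"
    proof (cases "s \<in> {a<..<b}")
      case True
      then show ?thesis using G_in calculation by blast
    next
      case False
      then show ?thesis using G_endpoints V_subspace[OF t] by (simp add: subspace_0)
    qed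
    ultimately show ?thesis
      unfolding field_def using V_subspace[OF t] by (intro subspace_diff subspace_scale) auto
  qed
  then have "integral {a..t} (field x) \<in> V t"
    by (rule integral_in_closed_subspace[OF V_subspace[OF t] V_closed[OF t]])
  moreover have "x\<^sub>0 \<in> V t"
    using x\<^sub>0 V_mono[of a t] t by auto
  ultimately show "evolve x t \<in> V t"
    unfolding evolve_def using V_subspace[OF t] S_in[OF t] by (intro subspace_add) auto
qed

lemma adapted_path_delay:
  assumes x: "adapted_path x" and "\<delta> \<ge> 0"
  shows "adapted_path (delay \<delta> x)"
  unfolding adapted_path_def delay_def
proof (intro conjI ballI)
  show "continuous_on {a..b} (\<lambda>s. x (max a (s - \<delta>)))"
  proof (rule continuous_on_compose2[of "{a..b}" x])
    show "continuous_on {a..b} x"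
      using x by (simp add: adapted_path_def)
    show "continuous_on {a..b} (\<lambda>s. max a (s - \<delta>))"
      by (intro continuous_intros)
    show "(\<lambda>s. max a (s - \<delta>)) ` {a..b} \<subseteq> {a..b}"
      using assms(2) by auto
  qed
  fix s assume "s \<in> {a..b}"
  then have "V (max a (s - \<delta>)) \<subseteq> V s" "max a (s - \<delta>) \<in> {a..b}"
    using assms(2) by (intro V_mono, auto)
  then show "x (max a (s - \<delta>)) \<in> V s"
    using x by (auto simp: adapted_path_def)
qed

lemma norm_G_le:
  assumes "s \<in> {a..b}" "x \<in> V s"
  shows "norm (G s x) \<le> K * (1 + norm x)"
  using assms K G_growth[of s x] G_endpoints[of s x] by (cases "s \<in> {a<..<b}") auto

lemma norm_field_le:
  assumes "adapted_path x" "s \<in> {a..b}" "norm (x s) \<le> r"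
  shows "norm (field x s) \<le> K + (L + K) * r"
proof -
  have "norm (field x s) \<le> norm (L *\<^sub>R x s) + norm (G s (x s))"
    unfolding field_def by (rule norm_triangle_ineq4)
  also have "\<dots> \<le> L * norm (x s) + K * (1 + norm (x s))"
    using assms L by (intro add_mono norm_G_le) (auto simp: adapted_path_def)
  also have "\<dots> \<le> L * r + K * (1 + r)"
    using assms(3) L K by (intro add_mono mult_left_mono) auto
  finally show ?thesis by (simp add: algebra_simps)
qed


subsection \<open>Tonelli's delayed approximations\<close>

definition S_bound :: real where
  "S_bound = (SUP t\<in>{a..b}. norm (x\<^sub>0 + (S t - S a)))"

text \<open>An explicit supersolution of the Gronwall inequality for the norm. The prefactor absorbs
  the noise and the constant part \<open>K\<close> of the growth; the 1 in the rate keeps it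
  positive even if \<open>L + K = 0\<close>, so that one can divide by it.\<close>

definition growth_bound :: "real \<Rightarrow> real" where
  "growth_bound t = (S_bound + K * (b - a)) * exp ((L + K + 1) * (t - a))"

lemma norm_S_le:
  assumes "t \<in> {a..b}"
  shows "norm (x\<^sub>0 + (S t - S a)) \<le> S_bound"
  unfolding S_bound_def
proof (rule cSUP_upper[OF assms])
  have "compact ((\<lambda>t. norm (x\<^sub>0 + (S t - S a))) ` {a..b})"
    by (intro compact_continuous_image continuous_intros S_continuous) simp
  then show "bdd_above ((\<lambda>t. norm (x\<^sub>0 + (S t - S a))) ` {a..b})"
    by (intro bounded_imp_bdd_above compact_imp_bounded)
qed

lemma S_bound_nonneg: "0 \<le> S_bound"
  using order_trans[OF norm_ge_zero norm_S_le[of a]] ab by simp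

lemma growth_bound_mono:
  assumes "s \<le> t"
  shows "growth_bound s \<le> growth_bound t"
  unfolding growth_bound_def using assms S_bound_nonneg K L ab
  by (intro mult_left_mono) (auto intro!: mult_left_mono)

text \<open>Paths below \<open>growth_bound\<close> are stable under \<open>evolve\<close>:
  integrating \<open>B * A * exp\<close> returns the exponential minus \<open>A\<close>, and this
  \<open>A\<close> pays for \<open>S_bound + K * (t - a)\<close>.\<close>

lemma norm_evolve_le:
  assumes x: "adapted_path x" and le: "\<And>s. s \<in> {a..b} \<Longrightarrow> norm (x s) \<le> growth_bound s"
    and t: "t \<in> {a..b}"
  shows "norm (evolve x t) \<le> growth_bound t"
proof -
  define A B where "A = S_bound + K * (b - a)" and "B = L + K + 1"
  have A: "A \<ge> 0" and B: "B > 0"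
    using S_bound_nonneg K L ab by (auto simp: A_def B_def)
  have "((\<lambda>s. A * exp (B * (s - a)) + K) has_integral
      ((A / B * exp (B * (t - a)) + K * t) - (A / B * exp (B * (a - a)) + K * a))) {a..t}"
    using t B by (intro fundamental_theorem_of_calculus)
      (auto intro!: derivative_eq_intros simp: has_real_derivative_iff_has_vector_derivative[symmetric])
  then have int: "((\<lambda>s. A * exp (B * (s - a)) + K) has_integral
      (A / B * (exp (B * (t - a)) - 1) + K * (t - a))) {a..t}"
    by (simp add: algebra_simps)
  \<comment> \<open>\<open>int\<close> is multiplied by \<open>B\<close>, and the constant, then
    \<open>B * K\<close>, is corrected back to \<open>K\<close>.\<close>
  then have int': "((\<lambda>s. B * (A * exp (B * (s - a))) + K) has_integral
      (A * (exp (B * (t - a)) - 1) + K * (t - a))) {a..t}"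
  proof -
    have "((\<lambda>s. B * (A * exp (B * (s - a)) + K) + (K - B * K)) has_integral
        (B * (A / B * (exp (B * (t - a)) - 1) + K * (t - a)) + (K - B * K) * (t - a))) {a..t}"
      using t by (intro has_integral_add has_integral_mult_right int)
        (use has_integral_const_real[of "K - B * K" a t] in \<open>simp add: mult.commute\<close>)
    then show ?thesis using B by (simp add: algebra_simps)
  qed
  have "norm (integral {a..t} (field x)) \<le> integral {a..t} (\<lambda>s. B * (A * exp (B * (s - a))) + K)"
  proof (rule integral_norm_bound_integral)
    show "field x integrable_on {a..t}"
      using field_integrable[OF x] t by simp
    show "(\<lambda>s. B * (A * exp (B * (s - a))) + K) integrable_on {a..t}"
      using int' by blast
    fix s assume "s \<in> {a..t}"
    then have s: "s \<in> {a..b}" using t by auto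
    have "norm (field x s) \<le> K + (L + K) * growth_bound s"
      using norm_field_le[OF x s le[OF s]] .
    also have "\<dots> \<le> K + B * growth_bound s"
      using A unfolding B_def growth_bound_def A_def by (intro add_left_mono mult_right_mono) auto
    finally show "norm (field x s) \<le> B * (A * exp (B * (s - a))) + K"
      by (simp add: growth_bound_def A_def B_def)
  qed
  also have "\<dots> = A * (exp (B * (t - a)) - 1) + K * (t - a)"
    using int' by (rule integral_unique)
  finally have "norm (evolve x t) \<le> S_bound + (A * (exp (B * (t - a)) - 1) + K * (t - a))"
    unfolding evolve_def by (intro norm_triangle_mono norm_S_le[OF t])
  also have "\<dots> \<le> A * exp (B * (t - a))"
  proof -
    have "K * (t - a) \<le> K * (b - a)"
      using K t by (intro mult_left_mono) auto
    then show ?thesis by (simp add: A_def algebra_simps)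
  qed
  finally show ?thesis by (simp add: growth_bound_def A_def B_def)
qed

text \<open>Up to time \<open>a + (n + 1) * \<delta>\<close> the delayed field reads the path only
  up to \<open>a + n * \<delta>\<close>. Each iteration thus settles one more window of length
  \<open>\<delta>\<close>, and a finite iterate is already an exact solution. The bound is the same
  for all delays because \<open>growth_bound\<close> is increasing.\<close>

lemma delayed_solution:
  assumes \<delta>: "\<delta> > 0"
  obtains x where "adapted_path x" "\<And>t. t \<in> {a..b} \<Longrightarrow> x t = evolve (delay \<delta> x) t"
    "\<And>t. t \<in> {a..b} \<Longrightarrow> norm (x t) \<le> growth_bound b"
proof -
  define y where "y n = ((\<lambda>x. evolve (delay \<delta> x)) ^^ n) (\<lambda>_. x\<^sub>0)" for n
  have y_Suc: "y (Suc n) = evolve (delay \<delta> (y n))" for n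
    by (simp add: y_def)
  have "adapted_path (\<lambda>_. x\<^sub>0)"
    by (auto simp: adapted_path_def intro!: subsetD[OF V_mono[OF order_refl] x\<^sub>0])
  then have y: "adapted_path (y n)" for n
  proof (induction n)
    case (Suc n)
    then show ?case
      using \<delta> by (simp add: y_Suc adapted_path_evolve adapted_path_delay)
  qed (simp add: y_def)
  have bound: "\<forall>t\<in>{a..b}. norm (y n t) \<le> growth_bound t" for n
  proof (induction n)
    case 0
    have "norm x\<^sub>0 \<le> S_bound"
      using norm_S_le[of a] ab by simp
    also have "\<dots> \<le> growth_bound a"
      using K ab by (simp add: growth_bound_def)
    finally have "norm x\<^sub>0 \<le> growth_bound t" if "a \<le> t" for t
      using growth_bound_mono[OF that] by simp
    then show ?case by (simp add: y_def)
  next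
    case (Suc n)
    show ?case
      unfolding y_Suc
    proof (intro ballI norm_evolve_le adapted_path_delay y)
      fix s assume s: "s \<in> {a..b}"
      then have "norm (delay \<delta> (y n) s) \<le> growth_bound (max a (s - \<delta>))"
        using Suc \<delta> by (simp add: delay_def)
      also have "\<dots> \<le> growth_bound s"
        using s \<delta> by (intro growth_bound_mono) auto
      finally show "norm (delay \<delta> (y n) s) \<le> growth_bound s" .
    qed (use \<delta> in auto)
  qed
  have stable: "\<forall>t\<in>{a..b}. t \<le> a + real n * \<delta> \<longrightarrow> y (Suc n) t = y n t" for n
  proof (induction n)
    case 0
    \<comment> \<open>Only \<open>t = a\<close> qualifies; the integral is over a point and both
      iterates equal \<open>x\<^sub>0\<close>.\<close>
    show ?case by (auto simp: y_Suc evolve_def) (simp add: y_def)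
  next
    case (Suc n)
    show ?case
    proof (intro ballI impI)
      fix t assume t: "t \<in> {a..b}" "t \<le> a + real (Suc n) * \<delta>"
      have "delay \<delta> (y (Suc n)) s = delay \<delta> (y n) s" if "s \<in> {a..t}" for s
        unfolding delay_def
        using that t \<delta> by (intro Suc[rule_format]) (auto simp: algebra_simps)
      then have "integral {a..t} (field (delay \<delta> (y (Suc n)))) = integral {a..t} (field (delay \<delta> (y n)))"
        by (intro integral_cong) (simp add: field_def)
      then show "y (Suc (Suc n)) t = y (Suc n) t"
        unfolding y_Suc[of "Suc n"] unfolding y_Suc[of n] evolve_def by simp
    qed
  qed
  obtain n where n: "b - a < real n * \<delta>"
    using reals_Archimedean3[OF \<delta>] by blast
  show ?thesis
  proof
    show "adapted_path (y n)" by (rule y)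
    fix t assume t: "t \<in> {a..b}"
    then show "y n t = evolve (delay \<delta> (y n)) t"
      using stable[of n] n y_Suc[of n] by auto
    show "norm (y n t) \<le> growth_bound b"
      using bound[of n] t growth_bound_mono[of t b] by force
  qed
qed


subsection \<open>Stability, uniqueness and existence\<close>

text \<open>The exponential weight turns the differential inequality
  \<open>(\<parallel>x - y\<parallel>\<^sup>2)' \<le> 2 L \<parallel>x - y\<parallel>\<^sup>2 + 8 R \<epsilon>\<close>, which holds because the drift is monotone, into the
  statement that a function is nonincreasing.\<close>

lemma stability:
  assumes x: "adapted_path x" "\<And>t. t \<in> {a..b} \<Longrightarrow> x t = x\<^sub>0 + (S t - S a) + integral {a..t} f"
    and y: "adapted_path y" "\<And>t. t \<in> {a..b} \<Longrightarrow> y t = x\<^sub>0 + (S t - S a) + integral {a..t} g"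
    and f: "f integrable_on {a..b}" "continuous_on {a<..<b} f"
      "\<And>s. s \<in> {a<..<b} \<Longrightarrow> norm (f s - field x s) \<le> \<epsilon>"
    and g: "g integrable_on {a..b}" "continuous_on {a<..<b} g"
      "\<And>s. s \<in> {a<..<b} \<Longrightarrow> norm (g s - field y s) \<le> \<epsilon>"
    and R: "\<And>t. t \<in> {a..b} \<Longrightarrow> norm (x t) \<le> R" "\<And>t. t \<in> {a..b} \<Longrightarrow> norm (y t) \<le> R"
    and t: "t \<in> {a..b}"
  shows "(norm (x t - y t))\<^sup>2 \<le> 8 * R * \<epsilon> * (b - a) * exp (2 * L * (b - a))"
proof -
  define z where "z s = x s - y s" for s
  define w where "w s = f s - g s" for s
  define \<phi> where "\<phi> s = exp (- 2 * L * (s - a)) * inner (z s) (z s) - 8 * R * \<epsilon> * (s - a)" for s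
  have w: "w integrable_on {a..b}"
    unfolding w_def by (intro integrable_diff f g)
  have z_eq: "z s = integral {a..s} w" if "s \<in> {a..b}" for s
  proof -
    have "f integrable_on {a..s}" "g integrable_on {a..s}"
      using that f(1) g(1) by (auto elim!: integrable_on_subinterval)
    then show ?thesis
      using that x(2) y(2) by (simp add: z_def w_def[abs_def] integral_diff)
  qed
  have deriv: "(z has_vector_derivative w s) (at s)" if s: "s \<in> {a<..<b}" for s
  proof -
    have "continuous (at s) w"
      unfolding w_def using f(2) g(2) s
      by (intro continuous_intros) (auto simp: continuous_on_eq_continuous_at)
    then have "((\<lambda>u. integral {a..u} w) has_vector_derivative w s) (at s within ({a..b} - {}))"
      using s by (intro integral_has_vector_derivative_continuous_at w)
        (auto intro: continuous_at_imp_continuous_at_within)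
    then have "((\<lambda>u. integral {a..u} w) has_vector_derivative w s) (at s within {a<..<b})"
      by (rule has_vector_derivative_within_subset) auto
    then have "((\<lambda>u. integral {a..u} w) has_vector_derivative w s) (at s)"
      by (simp only: at_within_open[OF s open_greaterThanLessThan])
    then show ?thesis
      by (rule has_vector_derivative_transform_within_open[of _ _ _ "{a<..<b}"])
        (use s z_eq in auto)
  qed
  have "R \<ge> 0"
    by (rule order_trans[OF norm_ge_zero R(1)[OF t]])
  \<comment> \<open>\<open>r\<close> collects the two defects, so
    \<open>norm r \<le> 2 * \<epsilon>\<close> while \<open>norm (z s) \<le> 2 * R\<close>. The
    product \<open>4 * R * \<epsilon>\<close> doubles to \<open>8 * R * \<epsilon>\<close> in the
    derivative of the square.\<close>
  have key: "inner (z s) (w s) \<le> L * inner (z s) (z s) + 4 * R * \<epsilon>" if s: "s \<in> {a<..<b}" for s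
  proof -
    have s': "s \<in> {a..b}" using s by auto
    define r where "r = (f s - field x s) - (g s - field y s)"
    have w_eq: "w s = L *\<^sub>R z s - (G s (x s) - G s (y s)) + r"
      by (simp add: w_def r_def field_def z_def algebra_simps)
    have "inner (z s) (G s (x s) - G s (y s)) \<ge> 0"
      using x(1) y(1) s s' unfolding z_def by (intro G_monotone) (auto simp: adapted_path_def)
    moreover have "inner (z s) r \<le> (2 * R) * (2 * \<epsilon>)"
    proof -
      have "norm (z s) \<le> 2 * R"
        unfolding z_def using R(1)[OF s'] R(2)[OF s'] norm_triangle_ineq4[of "x s" "y s"] by linarith
      moreover have "norm r \<le> 2 * \<epsilon>"
        unfolding r_def using f(3)[OF s] g(3)[OF s]
          norm_triangle_ineq4[of "f s - field x s" "g s - field y s"] by linarith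
      ultimately have "norm (z s) * norm r \<le> (2 * R) * (2 * \<epsilon>)"
        using \<open>R \<ge> 0\<close> by (intro mult_mono) auto
      then show ?thesis
        by (rule order_trans[OF norm_cauchy_schwarz])
    qed
    ultimately show ?thesis
      unfolding w_eq by (simp add: inner_add_right inner_diff_right)
  qed
  have "\<phi> t \<le> \<phi> a"
  proof (rule DERIV_nonpos_imp_decreasing_open[of a t \<phi>])
    show "a \<le> t" using t by simp
    show "continuous_on {a..t} \<phi>"
    proof -
      have "continuous_on {a..t} z"
        using x(1) y(1) t unfolding z_def
        by (intro continuous_intros) (auto simp: adapted_path_def intro: continuous_on_subset)
      then show ?thesis
        unfolding \<phi>_def by (intro continuous_intros)
    qed
    fix s assume "a < s" "s < t"
    then have s: "s \<in> {a<..<b}" using t by auto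
    have "((\<lambda>s. inner (z s) (z s)) has_real_derivative 2 * inner (z s) (w s)) (at s)"
      unfolding has_field_derivative_def
      by (rule has_derivative_eq_rhs[OF has_derivative_inner[OF
            deriv[OF s, unfolded has_vector_derivative_def]
            deriv[OF s, unfolded has_vector_derivative_def]]])
        (simp add: inner_commute fun_eq_iff)
    then have "(\<phi> has_real_derivative
        exp (- 2 * L * (s - a)) * (2 * inner (z s) (w s) - 2 * L * inner (z s) (z s)) - 8 * R * \<epsilon>) (at s)"
      unfolding \<phi>_def by (auto intro!: derivative_eq_intros simp: algebra_simps)
    moreover have "exp (- 2 * L * (s - a)) * (2 * inner (z s) (w s) - 2 * L * inner (z s) (z s))
        \<le> 8 * R * \<epsilon>"
    proof -
      have "0 \<le> \<epsilon>"
        by (rule order_trans[OF norm_ge_zero f(3)[OF s]])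
      then have "0 \<le> 8 * R * \<epsilon>" using \<open>R \<ge> 0\<close> by simp
      have "exp (- 2 * L * (s - a)) * (2 * inner (z s) (w s) - 2 * L * inner (z s) (z s))
          \<le> exp (- 2 * L * (s - a)) * (8 * R * \<epsilon>)"
        using key[OF s] by (intro mult_left_mono) auto
      also have "\<dots> \<le> 1 * (8 * R * \<epsilon>)"
        using L s \<open>0 \<le> 8 * R * \<epsilon>\<close> by (intro mult_right_mono) auto
      finally show ?thesis by simp
    qed
    ultimately show "\<exists>d. (\<phi> has_real_derivative d) (at s) \<and> d \<le> 0"
      by fastforce
  qed
  moreover have "z a = 0"
    using z_eq[of a] ab by simp
  ultimately have "exp (- 2 * L * (t - a)) * inner (z t) (z t) \<le> 8 * R * \<epsilon> * (t - a)"
    by (simp add: \<phi>_def)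
  then have "exp (2 * L * (t - a)) * (exp (- 2 * L * (t - a)) * inner (z t) (z t))
      \<le> exp (2 * L * (t - a)) * (8 * R * \<epsilon> * (t - a))"
    by (intro mult_left_mono) auto
  then have "inner (z t) (z t) \<le> exp (2 * L * (t - a)) * (8 * R * \<epsilon> * (t - a))"
    by (simp add: mult.assoc[symmetric] exp_add[symmetric])
  also have "\<dots> \<le> exp (2 * L * (b - a)) * (8 * R * \<epsilon> * (b - a))"
  proof -
    \<comment> \<open>The defect bound at any interior time gives \<open>\<epsilon> \<ge> 0\<close>;
      the midpoint is such a time.\<close>
    have "(a + b) / 2 \<in> {a<..<b}" using ab by auto
    then have "0 \<le> \<epsilon>"
      by (rule order_trans[OF norm_ge_zero f(3)])
    then show ?thesis
      using \<open>R \<ge> 0\<close> L t by (intro mult_mono) (auto intro!: mult_left_mono)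
  qed
  finally show ?thesis
    by (simp add: z_def power2_norm_eq_inner mult_ac)
qed

definition solution :: "(real \<Rightarrow> 'v) \<Rightarrow> bool" where
  "solution x \<longleftrightarrow> adapted_path x \<and> (\<forall>t\<in>{a..b}. x t = evolve x t)"

text \<open>Stability with defect 0. The radius comes from compactness of the two paths and
  disappears from the conclusion.\<close>

lemma solution_unique:
  assumes x: "solution x" and y: "solution y" and t: "t \<in> {a..b}"
  shows "x t = y t"
proof -
  have xy: "adapted_path x" "adapted_path y"
    "\<And>t. t \<in> {a..b} \<Longrightarrow> x t = x\<^sub>0 + (S t - S a) + integral {a..t} (field x)"
    "\<And>t. t \<in> {a..b} \<Longrightarrow> y t = x\<^sub>0 + (S t - S a) + integral {a..t} (field y)"
    using x y by (auto simp: solution_def evolve_def)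
  obtain R1 where R1: "\<And>t. t \<in> {a..b} \<Longrightarrow> norm (x t) \<le> R1"
    using adapted_path_bounded[OF xy(1)] by blast
  obtain R2 where R2: "\<And>t. t \<in> {a..b} \<Longrightarrow> norm (y t) \<le> R2"
    using adapted_path_bounded[OF xy(2)] by blast
  have "(norm (x t - y t))\<^sup>2 \<le> 8 * max R1 R2 * 0 * (b - a) * exp (2 * L * (b - a))"
    by (rule stability[OF xy(1,3) xy(2,4) field_integrable[OF xy(1)] field_continuous[OF xy(1)] _
          field_integrable[OF xy(2)] field_continuous[OF xy(2)] _ _ _ t])
      (simp_all add: R1 R2 le_max_iff_disj)
  then show ?thesis by simp
qed

text \<open>\<open>\<eta>\<close> depends on \<open>\<epsilon>\<close> and \<open>R\<close> alone,
  so that closeness of paths becomes closeness of fields uniformly in time and over the whole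
  approximating family.\<close>

lemma field_close:
  assumes "\<epsilon> > 0"
  obtains \<eta> where "\<eta> > 0"
    "\<And>x y s. s \<in> {a..b} \<Longrightarrow> x s \<in> V s \<Longrightarrow> y s \<in> V s \<Longrightarrow> norm (x s) \<le> R \<Longrightarrow> norm (y s) \<le> R
      \<Longrightarrow> norm (x s - y s) < \<eta> \<Longrightarrow> norm (field x s - field y s) < \<epsilon>"
proof -
  obtain \<delta> where \<delta>: "\<delta> > 0" and G: "\<And>s x y. a < s \<Longrightarrow> s < b \<Longrightarrow> x \<in> V s \<Longrightarrow> y \<in> V s
      \<Longrightarrow> norm x \<le> R \<Longrightarrow> norm y \<le> R \<Longrightarrow> norm (x - y) < \<delta> \<Longrightarrow> norm (G s x - G s y) < \<epsilon> / 2"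
    using G_uniform[of "\<epsilon> / 2" R] assms by fastforce
  \<comment> \<open>Half of \<open>\<epsilon>\<close> goes to \<open>G\<close>, half to the linear
    term; \<open>L + 1\<close> allows for \<open>L = 0\<close>.\<close>
  define \<eta> where "\<eta> = min \<delta> (\<epsilon> / (2 * (L + 1)))"
  show ?thesis
  proof
    show "\<eta> > 0" using \<delta> assms L by (simp add: \<eta>_def)
    fix x y :: "real \<Rightarrow> 'v" and s
    assume s: "s \<in> {a..b}" "x s \<in> V s" "y s \<in> V s" "norm (x s) \<le> R" "norm (y s) \<le> R"
      and close: "norm (x s - y s) < \<eta>"
    have "norm (G s (x s) - G s (y s)) < \<epsilon> / 2"
    proof (cases "s \<in> {a<..<b}")
      case True
      then show ?thesis using s close by (intro G) (auto simp: \<eta>_def)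
    next
      case False
      then show ?thesis using assms by (simp add: G_endpoints)
    qed
    moreover have "L * norm (x s - y s) \<le> \<epsilon> / 2"
    proof -
      have "L * norm (x s - y s) \<le> (L + 1) * (\<epsilon> / (2 * (L + 1)))"
        using close L by (intro mult_mono) (auto simp: \<eta>_def)
      also have "\<dots> = \<epsilon> / 2"
        using L by (simp add: nonzero_divide_eq_eq nonzero_eq_divide_eq)
      finally show ?thesis .
    qed
    moreover have "norm (field x s - field y s) \<le> norm (L *\<^sub>R (x s - y s)) + norm (G s (x s) - G s (y s))"
      using norm_triangle_ineq4[of "L *\<^sub>R (x s - y s)" "G s (x s) - G s (y s)"]
      by (simp add: field_def algebra_simps)
    ultimately show "norm (field x s - field y s) < \<epsilon>"
      using L by simp
  qed
qed

lemma solution_exists: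
  obtains x where "solution x"
proof -
  define R where "R = growth_bound b"
  have "\<exists>x. adapted_path x \<and> (\<forall>t\<in>{a..b}. x t = evolve (delay (1 / Suc n) x) t)
      \<and> (\<forall>t\<in>{a..b}. norm (x t) \<le> R)" for n
    unfolding R_def by (rule delayed_solution[of "1 / Suc n"]) auto
  then obtain y where y: "\<And>n. adapted_path (y n)"
    and y_eq: "\<And>n t. t \<in> {a..b} \<Longrightarrow> y n t = evolve (delay (1 / Suc n) (y n)) t"
    and y_bound: "\<And>n t. t \<in> {a..b} \<Longrightarrow> norm (y n t) \<le> R"
    by metis
  define d where "d n = delay (1 / Suc n) (y n)" for n
  have d: "adapted_path (d n)" for n
    unfolding d_def by (intro adapted_path_delay y) simp
  have d_in: "max a (s - 1 / Suc n) \<in> {a..b}" if "s \<in> {a..b}" for s n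
    using that by (auto simp: diff_le_eq intro: order_trans)
  have d_bound: "norm (d n s) \<le> R" if "s \<in> {a..b}" for n s
    unfolding d_def delay_def by (intro y_bound d_in that)
  have R: "R \<ge> 0"
    using order_trans[OF norm_ge_zero y_bound[of a]] ab by simp
  have mem: "y n s \<in> V s" "d n s \<in> V s" if "s \<in> {a..b}" for n s
    using y d that by (auto simp: adapted_path_def)
  have y_eq': "y n t = x\<^sub>0 + (S t - S a) + integral {a..t} (field (d n))" if "t \<in> {a..b}" for n t
    using y_eq[OF that] by (simp add: d_def evolve_def)

  \<comment> \<open>Bounds all delayed fields at once. The approximations are therefore
    equicontinuous, with the modulus of \<open>S\<close> plus \<open>C\<close> times the elapsed
    time.\<close>
  define C where "C = K + (L + K) * R"
  have C: "C \<ge> 0" using K L R by (simp add: C_def)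
  have equi: "norm (y n t - y n s) \<le> norm (S t - S s) + C * (t - s)" if "a \<le> s" "s \<le> t" "t \<le> b" for n s t
  proof -
    have int: "field (d n) integrable_on {a..t}"
      by (rule field_integrable[OF d that(3)])
    then have int': "field (d n) integrable_on {s..t}"
      by (rule integrable_on_subinterval) (use that in auto)
    have "integral {a..s} (field (d n)) + integral {s..t} (field (d n)) = integral {a..t} (field (d n))"
      using that int by (intro Henstock_Kurzweil_Integration.integral_combine) auto
    then have "y n t - y n s = (S t - S s) + integral {s..t} (field (d n))"
      using that by (simp add: y_eq' algebra_simps)
    moreover have "norm (integral {s..t} (field (d n))) \<le> C * (t - s)"
    proof -
      have "norm (integral {s..t} (field (d n))) \<le> C * measure lborel {s..t}"
        using that by (intro has_integral_bound_real[OF C _ integrable_integral[OF int']])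
          (auto simp: C_def intro!: norm_field_le[OF d] d_bound)
      then show ?thesis using that by simp
    qed
    ultimately show ?thesis
      using norm_triangle_ineq[of "S t - S s" "integral {s..t} (field (d n))"] by simp
  qed
  \<comment> \<open>A path and its delayed version differ by an increment over a time of at most
    \<open>1 / Suc n\<close>, small by equicontinuity.\<close>
  have delay_close: "\<exists>N. \<forall>n\<ge>N. \<forall>s\<in>{a..b}. norm (d n s - y n s) < \<epsilon>" if "\<epsilon> > 0" for \<epsilon>
  proof -
    have "uniformly_continuous_on {a..b} S"
      using S_continuous by (intro compact_uniformly_continuous) auto
    then obtain \<delta> where \<delta>: "\<delta> > 0"
      "\<And>s t. s \<in> {a..b} \<Longrightarrow> t \<in> {a..b} \<Longrightarrow> dist t s < \<delta> \<Longrightarrow> dist (S t) (S s) < \<epsilon> / 2"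
      using half_gt_zero[OF \<open>\<epsilon> > 0\<close>] by (rule uniformly_continuous_onE) blast
    have "0 < min \<delta> (\<epsilon> / (2 * (C + 1)))"
      using \<delta>(1) \<open>\<epsilon> > 0\<close> C by simp
    then obtain N where N: "1 / Suc N < min \<delta> (\<epsilon> / (2 * (C + 1)))"
      using nat_approx_posE by blast
    have "norm (d n s - y n s) < \<epsilon>" if "n \<ge> N" "s \<in> {a..b}" for n s
    proof -
      let ?r = "max a (s - 1 / Suc n)"
      have "1 / Suc n \<le> 1 / Suc N"
        using \<open>n \<ge> N\<close> by (simp add: frac_le)
      then have r: "s - ?r < \<delta>" "s - ?r \<le> \<epsilon> / (2 * (C + 1))" "?r \<le> s" "?r \<in> {a..b}"
        using N that d_in[of s n] by auto
      have "norm (d n s - y n s) \<le> norm (S s - S ?r) + C * (s - ?r)"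
        unfolding d_def delay_def using equi[of ?r s n] r that by (simp add: norm_minus_commute)
      also have "C * (s - ?r) \<le> (C + 1) * (\<epsilon> / (2 * (C + 1)))"
        using C r by (intro mult_mono) auto
      also have "\<dots> = \<epsilon> / 2"
        using C by (simp add: nonzero_divide_eq_eq nonzero_eq_divide_eq)
      finally have "norm (d n s - y n s) \<le> norm (S s - S ?r) + \<epsilon> / 2" by simp
      moreover have "norm (S s - S ?r) < \<epsilon> / 2"
        using \<delta>(2)[of ?r s] r that by (simp add: dist_norm)
      ultimately show ?thesis by linarith
    qed
    then show ?thesis by blast
  qed
  \<comment> \<open>This is the error with which \<open>y n\<close> solves the undelayed equation,
    to be fed into \<open>stability\<close>.\<close>
  have defect: "\<exists>N. \<forall>n\<ge>N. \<forall>s\<in>{a..b}. norm (field (d n) s - field (y n) s) < \<epsilon>" if \<epsilon>: "\<epsilon> > 0" for \<epsilon>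
  proof -
    obtain \<eta> where \<eta>: "\<eta> > 0" and close: "\<And>x y s. s \<in> {a..b} \<Longrightarrow> x s \<in> V s \<Longrightarrow> y s \<in> V s
        \<Longrightarrow> norm (x s) \<le> R \<Longrightarrow> norm (y s) \<le> R \<Longrightarrow> norm (x s - y s) < \<eta>
        \<Longrightarrow> norm (field x s - field y s) < \<epsilon>"
      by (rule field_close[OF \<epsilon>, where R = R]) blast
    obtain N where N: "\<And>n s. n \<ge> N \<Longrightarrow> s \<in> {a..b} \<Longrightarrow> norm (d n s - y n s) < \<eta>"
      using delay_close[OF \<eta>] by blast
    show ?thesis
      by (intro exI[of _ N] allI impI ballI close mem y_bound d_bound N)
  qed
  have "uniformly_Cauchy_on {a..b} y"
    unfolding uniformly_Cauchy_on_def
  proof (intro allI impI)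
    fix e :: real assume "e > 0"
    define B where "B = 8 * R * (b - a) * exp (2 * L * (b - a))"
    have B: "B \<ge> 0" using R ab by (simp add: B_def)
    \<comment> \<open>\<open>B * \<epsilon>\<close> is the bound given by \<open>stability\<close>;
      this choice keeps it below \<open>e^2\<close>, also when \<open>B = 0\<close>.\<close>
    define \<epsilon> where "\<epsilon> = e\<^sup>2 / (B + 1)"
    have \<epsilon>: "\<epsilon> > 0" using \<open>e > 0\<close> B by (simp add: \<epsilon>_def)
    have "B * \<epsilon> < e\<^sup>2"
      using B \<open>e > 0\<close> by (simp add: \<epsilon>_def field_simps)
    obtain N where N: "\<And>n s. n \<ge> N \<Longrightarrow> s \<in> {a..b} \<Longrightarrow> norm (field (d n) s - field (y n) s) < \<epsilon>"
      using defect[OF \<epsilon>] by blast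
    have "dist (y m t) (y n t) < e" if "t \<in> {a..b}" "m \<ge> N" "n \<ge> N" for t m n
    proof -
      have "(norm (y m t - y n t))\<^sup>2 \<le> 8 * R * \<epsilon> * (b - a) * exp (2 * L * (b - a))"
      proof (rule stability[OF y y_eq' y y_eq' field_integrable[OF d order_refl] field_continuous[OF d] _
            field_integrable[OF d order_refl] field_continuous[OF d] _ y_bound y_bound that(1)])
        show "norm (field (d m) s - field (y m) s) \<le> \<epsilon>" if "s \<in> {a<..<b}" for s
          using N[of m s] that \<open>m \<ge> N\<close> by auto
        show "norm (field (d n) s - field (y n) s) \<le> \<epsilon>" if "s \<in> {a<..<b}" for s
          using N[of n s] that \<open>n \<ge> N\<close> by auto
      qed
      also have "\<dots> = B * \<epsilon>" by (simp add: B_def)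
      also have "\<dots> < e\<^sup>2" by fact
      finally show ?thesis
        using \<open>e > 0\<close> by (simp add: dist_norm power_less_imp_less_base)
    qed
    then show "\<exists>M. \<forall>t\<in>{a..b}. \<forall>m\<ge>M. \<forall>n\<ge>M. dist (y m t) (y n t) < e"
      by blast
  qed
  then obtain x where lim: "uniform_limit {a..b} y x sequentially"
    using Cauchy_uniformly_convergent uniformly_convergent_on_def by blast
  have lim': "(\<lambda>n. y n t) \<longlonglongrightarrow> x t" if "t \<in> {a..b}" for t
    using tendsto_uniform_limitI[OF lim that] .
  have x: "adapted_path x"
    unfolding adapted_path_def
  proof (intro conjI ballI)
    show "continuous_on {a..b} x"
      by (rule uniform_limit_theorem[OF _ lim]) (use y in \<open>auto simp: adapted_path_def\<close>)
    show "x t \<in> V t" if "t \<in> {a..b}" for t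
      using closed_sequentially[OF V_closed[OF that] _ lim'[OF that]] mem(1)[OF that] by blast
  qed
  have x_bound: "norm (x t) \<le> R" if "t \<in> {a..b}" for t
    using tendsto_norm[OF lim'[OF that]] y_bound[OF that] by (intro LIMSEQ_le_const2) auto
  \<comment> \<open>The fields under the integral are those of \<open>d n\<close>; they are compared
    with that of the limit through \<open>y n\<close>.\<close>
  have field_lim: "\<exists>N. \<forall>n\<ge>N. \<forall>s\<in>{a..b}. norm (field (d n) s - field x s) < \<epsilon>" if "\<epsilon> > 0" for \<epsilon>
  proof -
    have \<epsilon>: "\<epsilon> / 2 > 0" using that by simp
    obtain \<eta> where \<eta>: "\<eta> > 0" and close: "\<And>x y s. s \<in> {a..b} \<Longrightarrow> x s \<in> V s \<Longrightarrow> y s \<in> V s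
        \<Longrightarrow> norm (x s) \<le> R \<Longrightarrow> norm (y s) \<le> R \<Longrightarrow> norm (x s - y s) < \<eta>
        \<Longrightarrow> norm (field x s - field y s) < \<epsilon> / 2"
      by (rule field_close[OF \<epsilon>, where R = R]) blast
    obtain N1 where N1: "\<And>n s. n \<ge> N1 \<Longrightarrow> s \<in> {a..b} \<Longrightarrow> norm (y n s - x s) < \<eta>"
      using uniform_limitD[OF lim \<eta>] unfolding eventually_sequentially dist_norm by blast
    obtain N2 where N2: "\<And>n s. n \<ge> N2 \<Longrightarrow> s \<in> {a..b} \<Longrightarrow> norm (field (d n) s - field (y n) s) < \<epsilon> / 2"
      using defect[OF \<epsilon>] by blast
    have "norm (field (d n) s - field x s) < \<epsilon>" if "n \<ge> max N1 N2" "s \<in> {a..b}" for n s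
    proof -
      have "norm (field (y n) s - field x s) < \<epsilon> / 2"
        using that x by (intro close mem y_bound x_bound N1) (auto simp: adapted_path_def)
      with N2[of n s] that show ?thesis
        using norm_triangle_ineq[of "field (d n) s - field (y n) s" "field (y n) s - field x s"]
        by simp
    qed
    then show ?thesis by blast
  qed
  have "x t = evolve x t" if t: "t \<in> {a..b}" for t
  proof -
    have "(\<lambda>n. integral {a..t} (field (d n))) \<longlonglongrightarrow> integral {a..t} (field x)"
    proof (rule LIMSEQ_I)
      fix e :: real assume "e > 0"
      define \<epsilon> where "\<epsilon> = e / (b - a + 1)"
      have \<epsilon>: "\<epsilon> > 0" using \<open>e > 0\<close> ab by (simp add: \<epsilon>_def)
      obtain N where N: "\<And>n s. n \<ge> N \<Longrightarrow> s \<in> {a..b} \<Longrightarrow> norm (field (d n) s - field x s) < \<epsilon>"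
        using field_lim[OF \<epsilon>] by blast
      have "norm (integral {a..t} (field (d n)) - integral {a..t} (field x)) < e" if "n \<ge> N" for n
      proof -
        have int: "field (d n) integrable_on {a..t}" "field x integrable_on {a..t}"
          using t by (auto intro: field_integrable d x)
        have "norm (integral {a..t} (field (d n)) - integral {a..t} (field x)) \<le> \<epsilon> * measure lborel {a..t}"
        proof (rule has_integral_bound_real)
          show "((\<lambda>s. field (d n) s - field x s) has_integral
              integral {a..t} (field (d n)) - integral {a..t} (field x)) {a..t}"
            using int by (intro has_integral_diff integrable_integral)
          show "norm (field (d n) s - field x s) \<le> \<epsilon>" if "s \<in> {a..t} - {}" for s
            using N[OF \<open>n \<ge> N\<close>, of s] t that by auto
        qed (use \<epsilon> in auto)
        also have "\<dots> \<le> \<epsilon> * (b - a)"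
          using t \<epsilon> by (intro mult_left_mono) auto
        also have "\<dots> < \<epsilon> * (b - a + 1)"
          using \<epsilon> by simp
        also have "\<dots> = e"
          using ab by (simp add: \<epsilon>_def)
        finally show ?thesis .
      qed
      then show "\<exists>N. \<forall>n\<ge>N. norm (integral {a..t} (field (d n)) - integral {a..t} (field x)) < e"
        by blast
    qed
    then have "(\<lambda>n. y n t) \<longlonglongrightarrow> evolve x t"
      unfolding y_eq'[OF t] evolve_def by (intro tendsto_add tendsto_const)
    then show ?thesis
      using lim'[OF t] LIMSEQ_unique by blast
  qed
  with x have "solution x"
    by (simp add: solution_def)
  then show ?thesis by (rule that)
qed

end

section \<open>Gradients with respect to the last entry\<close>

text \<open>The counterpart of \<open>path_tuple\<close> in which the past \<open>Q\<close> is
  frozen and the current state is a free variable.\<close>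

definition extend_tuple :: "nat \<Rightarrow> (nat \<Rightarrow> 'v::zero) \<Rightarrow> 'v \<Rightarrow> nat \<Rightarrow> 'v" where
  "extend_tuple i Q x = (\<lambda>j. if j < i then Q j else if j = i then x else 0)"

definition last_direction :: "nat \<Rightarrow> 'v::zero \<Rightarrow> nat \<Rightarrow> 'v" where
  "last_direction i z = (\<lambda>j. if j = i then z else 0)"

lemma extend_tuple_diff: "extend_tuple i Q x - extend_tuple i Q y = last_direction i (x - y)"
  for x y :: "'v::group_add"
  by (simp add: extend_tuple_def last_direction_def fun_eq_iff)

lemma extend_tuple_in:
  assumes "\<And>j. j < i \<Longrightarrow> Q j \<in> V" "x \<in> V"
  shows "extend_tuple i Q x \<in> tuples V i"
  using assms by (auto simp: tuples_def extend_tuple_def)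

lemma last_direction_in:
  assumes "subspace V" "z \<in> V"
  shows "last_direction i z \<in> tuples V i"
  using assms by (auto simp: tuples_def last_direction_def subspace_0)

lemma last_direction_add: "last_direction i (x + y) = last_direction i x + last_direction i y"
  for x y :: "'v::real_vector"
  by (simp add: last_direction_def fun_eq_iff)

lemma last_direction_scaleR: "last_direction i (r *\<^sub>R x) = r *\<^sub>R last_direction i x"
  for x :: "'v::real_vector"
  by (simp add: last_direction_def fun_eq_iff scaleR_fun_def)

section \<open>The Hilbert norm on tuples\<close>

lemma subspace_tuples: "subspace V \<Longrightarrow> subspace (tuples V i)"
  unfolding subspace_def tuples_def by (auto simp: scaleR_fun_def)

lemma tuple_norm_eq_L2_set: "tuple_norm i X = L2_set (\<lambda>j. norm (X j)) {..i}"
  by (simp add: tuple_norm_def L2_set_def)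

lemma tuple_norm_nonneg: "0 \<le> tuple_norm i X"
  by (simp add: tuple_norm_def sum_nonneg)

lemma tuple_norm_triangle: "tuple_norm i (X + Y) \<le> tuple_norm i X + tuple_norm i Y"
proof -
  have "tuple_norm i (X + Y) \<le> L2_set (\<lambda>j. norm (X j) + norm (Y j)) {..i}"
    unfolding tuple_norm_eq_L2_set by (intro L2_set_mono) (auto simp: norm_triangle_ineq)
  also have "\<dots> \<le> tuple_norm i X + tuple_norm i Y"
    unfolding tuple_norm_eq_L2_set by (rule L2_set_triangle_ineq)
  finally show ?thesis .
qed

lemma tuple_norm_last_direction [simp]: "tuple_norm i (last_direction i z) = norm z"
proof -
  have "(\<Sum>j\<le>i. (norm (last_direction i z j))\<^sup>2) = (\<Sum>j\<le>i. if j = i then (norm z)\<^sup>2 else 0)"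
    by (intro sum.cong) (auto simp: last_direction_def)
  then show ?thesis by (simp add: tuple_norm_def)
qed

lemma tuple_norm_extend_tuple:
  "tuple_norm i (extend_tuple i Q x) \<le> tuple_norm i (extend_tuple i Q 0) + norm x"
proof -
  have "extend_tuple i Q x = extend_tuple i Q 0 + last_direction i x"
    by (simp add: extend_tuple_def last_direction_def fun_eq_iff)
  then show ?thesis
    using tuple_norm_triangle[of i "extend_tuple i Q 0" "last_direction i x"] by simp
qed

text \<open>Resolves the definite description. The Gateaux derivative restricted to the last slot is
  a bounded functional on \<open>V\<close>, represented by Riesz; two representatives agree because
  their difference is an admissible direction.\<close>

lemma last_gradient:
  fixes V :: "'v::{real_inner,banach} set"
  assumes V: "subspace V" "closed V" and f: "gateaux_differentiable V i f X"
  shows "last_gradient V i f X \<in> V"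
    and "\<And>z. z \<in> V \<Longrightarrow> ((\<lambda>\<epsilon>. f (X + \<epsilon> *\<^sub>R last_direction i z))
      has_real_derivative inner (last_gradient V i f X) z) (at 0)"
proof -
  obtain f' K where f':
    "\<And>Y Z. Y \<in> tuples V i \<Longrightarrow> Z \<in> tuples V i \<Longrightarrow> f' (Y + Z) = f' Y + f' Z"
    "\<And>r Y. Y \<in> tuples V i \<Longrightarrow> f' (r *\<^sub>R Y) = r * f' Y"
    "\<And>Y. Y \<in> tuples V i \<Longrightarrow> \<bar>f' Y\<bar> \<le> K * tuple_norm i Y"
    "\<And>Y. Y \<in> tuples V i \<Longrightarrow> ((\<lambda>\<epsilon>. f (X + \<epsilon> *\<^sub>R Y)) has_real_derivative f' Y) (at 0)"
    using f unfolding gateaux_differentiable_def by (elim exE conjE) blast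
  note dir = last_direction_in[OF V(1)]
  obtain G where G: "G \<in> V" "\<And>z. z \<in> V \<Longrightarrow> f' (last_direction i z) = inner G z"
  proof (rule Riesz_closed_subspace[OF V, of "\<lambda>z. f' (last_direction i z)" K])
    show "\<bar>f' (last_direction i z)\<bar> \<le> K * norm z" if "z \<in> V" for z
      using f'(3)[OF dir[OF that]] by simp
  qed (simp_all add: last_direction_add last_direction_scaleR f' dir)
  let ?P = "\<lambda>G. G \<in> V \<and> (\<forall>z\<in>V. ((\<lambda>\<epsilon>. f (X + \<epsilon> *\<^sub>R last_direction i z))
      has_real_derivative inner G z) (at 0))"
  have "\<exists>!G. ?P G"
  proof (rule ex1I)
    show "?P G"
      using G f'(4)[OF dir] by metis
    fix G' assume G': "?P G'"
    have "inner G' z = inner G z" if "z \<in> V" for z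
      using G' \<open>?P G\<close> that DERIV_unique by blast
    then have "inner G' (G' - G) = inner G (G' - G)"
      using G' G(1) V(1) by (simp add: subspace_diff)
    then have "inner (G' - G) (G' - G) = 0"
      by (simp only: inner_diff_left)
    then show "G' = G" by simp
  qed
  then have "?P (THE G. ?P G)"
    by (rule theI')
  then have "?P (last_gradient V i f X)"
    unfolding last_gradient_def last_direction_def .
  then show "last_gradient V i f X \<in> V"
    and "\<And>z. z \<in> V \<Longrightarrow> ((\<lambda>\<epsilon>. f (X + \<epsilon> *\<^sub>R last_direction i z))
      has_real_derivative inner (last_gradient V i f X) z) (at 0)"
    by blast+
qed

text \<open>One-sided difference quotients suffice; the term with \<open>B\<close> is an error that
  vanishes as \<open>r\<close> tends to 0.\<close>

lemma derivative_le_right: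
  fixes \<phi> :: "real \<Rightarrow> real"
  assumes "(\<phi> has_real_derivative d) (at 0)"
    and le: "\<And>r. 0 < r \<Longrightarrow> r < 1 \<Longrightarrow> \<phi> r - \<phi> 0 \<le> r * (A + r * B)"
  shows "d \<le> A"
proof (rule tendsto_le)
  have "((\<lambda>r. (\<phi> r - \<phi> 0) / r) \<longlongrightarrow> d) (at 0)"
    using assms(1) by (simp add: DERIV_def)
  then show "((\<lambda>r. (\<phi> r - \<phi> 0) / r) \<longlongrightarrow> d) (at_right 0)"
    by (rule tendsto_within_subset) auto
  have "((\<lambda>r::real. A + r * B) \<longlongrightarrow> A + 0 * B) (at_right 0)"
    by (intro tendsto_intros)
  then show "((\<lambda>r::real. A + r * B) \<longlongrightarrow> A) (at_right 0)" by simp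
  have "eventually (\<lambda>r::real. r \<in> {0<..<1}) (at_right 0)"
    by (rule eventually_at_right_real) simp
  then show "eventually (\<lambda>r. (\<phi> r - \<phi> 0) / r \<le> A + r * B) (at_right 0)"
    by (rule eventually_mono) (use le in \<open>auto simp: divide_le_eq mult.commute\<close>)
qed simp

text \<open>The subgradient inequality: by convexity the chord from \<open>X\<close> to
  \<open>Y\<close> lies above the graph, so difference quotients at \<open>X\<close> do not exceed
  the full increment.\<close>

lemma last_gradient_le_increment:
  fixes V :: "'v::{real_inner,banach} set"
  assumes V: "subspace V" "closed V" and f: "gateaux_differentiable V i f X"
    and convex: "convex_on (tuples V i) f" and X: "X \<in> tuples V i"
    and Y: "Y \<in> tuples V i" "Y - X = last_direction i z" and z: "z \<in> V"
  shows "inner (last_gradient V i f X) z \<le> f Y - f X"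
proof (rule derivative_le_right[OF last_gradient(2)[OF V f z], where B = 0])
  fix r :: real assume r: "0 < r" "r < 1"
  have "X + r *\<^sub>R last_direction i z = (1 - r) *\<^sub>R X + r *\<^sub>R Y"
    unfolding Y(2)[symmetric] by (simp add: algebra_simps)
  then have "f (X + r *\<^sub>R last_direction i z) \<le> (1 - r) * f X + r * f Y"
    using convex_onD[OF convex, of r X Y] r X Y(1) by simp
  then show "f (X + r *\<^sub>R last_direction i z) - f (X + 0 *\<^sub>R last_direction i z)
      \<le> r * (f Y - f X + r * 0)"
    by (simp add: algebra_simps)
qed

text \<open>Add the subgradient inequalities from \<open>x\<close> to \<open>y\<close> and from
  \<open>y\<close> to \<open>x\<close>; the values of \<open>f\<close> cancel.\<close>

lemma last_gradient_monotone:
  fixes V :: "'v::{real_inner,banach} set"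
  assumes V: "subspace V" "closed V"
    and f: "\<And>X. X \<in> tuples V i \<Longrightarrow> gateaux_differentiable V i f X"
    and convex: "convex_on (tuples V i) f"
    and Q: "\<And>j. j < i \<Longrightarrow> Q j \<in> V" and xy: "x \<in> V" "y \<in> V"
  shows "0 \<le> inner (x - y)
    (last_gradient V i f (extend_tuple i Q x) - last_gradient V i f (extend_tuple i Q y))"
proof -
  have in_tuples: "extend_tuple i Q x \<in> tuples V i" "extend_tuple i Q y \<in> tuples V i"
    using Q xy by (auto intro: extend_tuple_in)
  have "inner (last_gradient V i f (extend_tuple i Q x)) (y - x)
      \<le> f (extend_tuple i Q y) - f (extend_tuple i Q x)"
    using in_tuples xy V(1)
    by (intro last_gradient_le_increment[OF V f convex]) (auto simp: extend_tuple_diff subspace_diff)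
  moreover have "inner (last_gradient V i f (extend_tuple i Q y)) (x - y)
      \<le> f (extend_tuple i Q x) - f (extend_tuple i Q y)"
    using in_tuples xy V(1)
    by (intro last_gradient_le_increment[OF V f convex]) (auto simp: extend_tuple_diff subspace_diff)
  ultimately show ?thesis
    by (simp add: inner_diff inner_commute)
qed

text \<open>Differentiate in the direction \<open>G\<close> of the gradient itself: the local
  Lipschitz constant at \<open>X\<close> tends to \<open>2 * C * tuple_norm i X + D\<close>, which
  bounds \<open>inner G G / norm G\<close>.\<close>

lemma norm_last_gradient_le:
  fixes V :: "'v::{real_inner,banach} set"
  assumes V: "subspace V" "closed V" and f: "gateaux_differentiable V i f X"
    and X: "X \<in> tuples V i" and CD: "C \<ge> 0" "D \<ge> 0"
    and lipschitz: "\<And>Y. Y \<in> tuples V i \<Longrightarrow>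
      \<bar>f Y - f X\<bar> \<le> tuple_norm i (Y - X) * (C * tuple_norm i Y + C * tuple_norm i X + D)"
  shows "norm (last_gradient V i f X) \<le> 2 * C * tuple_norm i X + D"
proof -
  define G where "G = last_gradient V i f X"
  have G: "G \<in> V"
    unfolding G_def by (rule last_gradient(1)[OF V f])
  have "inner G G \<le> norm G * (2 * C * tuple_norm i X + D)"
    unfolding G_def
  proof (rule derivative_le_right[OF last_gradient(2)[OF V f G[unfolded G_def]],
        where B = "C * (norm G)\<^sup>2"], fold G_def)
    fix r :: real assume r: "0 < r" "r < 1"
    let ?Y = "X + r *\<^sub>R last_direction i G"
    have step: "tuple_norm i (r *\<^sub>R last_direction i G) = r * norm G"
      using r tuple_norm_last_direction[of i "r *\<^sub>R G"] by (simp add: last_direction_scaleR)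
    have Y: "?Y \<in> tuples V i"
      using X last_direction_in[OF V(1) G] subspace_tuples[OF V(1)]
      by (intro subspace_add subspace_scale)
    have "f ?Y - f X \<le> (r * norm G) * (C * tuple_norm i ?Y + C * tuple_norm i X + D)"
      using lipschitz[OF Y] by (simp add: step)
    also have "\<dots> \<le> (r * norm G) * (C * (tuple_norm i X + r * norm G) + C * tuple_norm i X + D)"
      using r CD tuple_norm_triangle[of i X "r *\<^sub>R last_direction i G"]
      by (intro mult_left_mono add_right_mono) (auto simp: step)
    finally show "f ?Y - f (X + 0 *\<^sub>R last_direction i G)
        \<le> r * (norm G * (2 * C * tuple_norm i X + D) + r * (C * (norm G)\<^sup>2))"
      by (simp add: algebra_simps power2_eq_square)
  qed
  then have "norm G * norm G \<le> norm G * (2 * C * tuple_norm i X + D)"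
    by (simp add: power2_norm_eq_inner[symmetric] power2_eq_square)
  moreover have "0 \<le> 2 * C * tuple_norm i X + D"
    using CD by (simp add: tuple_norm_nonneg)
  ultimately show ?thesis
    unfolding G_def[symmetric] by (cases "norm G = 0") auto
qed

section \<open>The piecewise equation\<close>

lemma powr_small:
  fixes \<alpha> M \<epsilon> :: real
  assumes "\<alpha> > 0" "M \<ge> 0" "\<epsilon> > 0"
  obtains \<delta> where "\<delta> > 0" "\<And>u. 0 \<le> u \<Longrightarrow> u < \<delta> \<Longrightarrow> u powr \<alpha> * M < \<epsilon>"
proof
  \<comment> \<open>Solves \<open>\<delta> powr \<alpha> * (M + 1) = \<epsilon>\<close>; the 1 gives
    strictness and covers \<open>M = 0\<close>.\<close>
  define \<delta> where "\<delta> = (\<epsilon> / (M + 1)) powr (1 / \<alpha>)"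
  have pos: "\<epsilon> / (M + 1) > 0" using assms by simp
  then show "\<delta> > 0" unfolding \<delta>_def by auto
  fix u assume u: "0 \<le> u" "u < \<delta>"
  have "u powr \<alpha> \<le> \<delta> powr \<alpha>"
    using u assms by (intro powr_mono2) auto
  also have "\<dots> = \<epsilon> / (M + 1)"
    using pos assms by (simp add: \<delta>_def powr_powr)
  finally have "u powr \<alpha> * M \<le> \<epsilon> / (M + 1) * M"
    using assms by (intro mult_right_mono)
  also have "\<dots> < \<epsilon> / (M + 1) * (M + 1)"
    using pos by (intro mult_strict_left_mono) auto
  also have "\<dots> = \<epsilon>"
    using assms by simp
  finally show "u powr \<alpha> * M < \<epsilon>" .
qed

text \<open>The equation over an abstract increasing family of closed subspaces. Grid steps may be
  degenerate, as the last one is when the last grid point before \<open>T\<close> already equals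
  \<open>T\<close>.\<close>

locale gradient_evolution =
  fixes V :: "real \<Rightarrow> 'v::{real_inner,banach} set" and h :: "real \<Rightarrow> (nat \<Rightarrow> 'v) \<Rightarrow> real"
    and p :: "nat \<Rightarrow> real" and k :: nat and L C D \<alpha> \<beta> :: real
    and S :: "real \<Rightarrow> 'v" and x\<^sub>0 :: 'v
  assumes V_subspace: "\<And>t. t \<ge> 0 \<Longrightarrow> subspace (V t)"
    and V_closed: "\<And>t. t \<ge> 0 \<Longrightarrow> closed (V t)"
    and V_mono: "\<And>s t. 0 \<le> s \<Longrightarrow> s \<le> t \<Longrightarrow> V s \<subseteq> V t"
    and p_0: "p 0 = 0"
    and p_step: "\<And>i. i \<le> k \<Longrightarrow> p i \<le> p (Suc i)"
    and L: "L \<ge> 0"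
    and convex: "\<And>i t. i \<le> k \<Longrightarrow> t \<in> {p i<..<p (Suc i)} \<Longrightarrow> convex_on (tuples (V t) i) (h t)"
    and CD: "C \<ge> 0" "D \<ge> 0"
    and lipschitz: "\<And>i t X Y. i \<le> k \<Longrightarrow> t \<in> {p i<..<p (Suc i)} \<Longrightarrow> X \<in> tuples (V t) i
      \<Longrightarrow> Y \<in> tuples (V t) i \<Longrightarrow>
        \<bar>h t X - h t Y\<bar> \<le> tuple_norm i (X - Y) * (C * tuple_norm i X + C * tuple_norm i Y + D)"
    and gateaux: "\<And>i t X. i \<le> k \<Longrightarrow> t \<in> {p i<..<p (Suc i)} \<Longrightarrow> X \<in> tuples (V t) i
      \<Longrightarrow> gateaux_differentiable (V t) i (h t) X"
    and \<alpha>: "\<alpha> > 0" and \<beta>: "\<beta> > 0"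
    and grad_time: "\<And>i t s X. i \<le> k \<Longrightarrow> t \<in> {p i<..<p (Suc i)} \<Longrightarrow> s \<in> {p i<..<p (Suc i)} \<Longrightarrow> t < s
      \<Longrightarrow> X \<in> tuples (V t) i \<Longrightarrow>
        norm (last_gradient (V t) i (h t) X - last_gradient (V s) i (h s) X)
          \<le> \<bar>t - s\<bar> powr \<alpha> * (C + D * tuple_norm i X)"
    and grad_space: "\<And>i t X Y. i \<le> k \<Longrightarrow> t \<in> {p i<..<p (Suc i)} \<Longrightarrow> X \<in> tuples (V t) i
      \<Longrightarrow> Y \<in> tuples (V t) i \<Longrightarrow>
        norm (last_gradient (V t) i (h t) X - last_gradient (V t) i (h t) Y)
          \<le> tuple_norm i (X - Y) powr \<beta> * (C + D * tuple_norm i X + D * tuple_norm i Y)"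
    and S_continuous: "continuous_on {0..} S"
    and S_in: "\<And>t. t \<ge> 0 \<Longrightarrow> S t \<in> V t"
    and S_0: "S 0 = 0"
    and x\<^sub>0: "x\<^sub>0 \<in> V 0"
begin

lemma p_mono: "i \<le> j \<Longrightarrow> j \<le> Suc k \<Longrightarrow> p i \<le> p j"
proof (induction j rule: dec_induct)
  case (step j)
  then show ?case using p_step[of j] by simp
qed simp

lemma p_nonneg: "i \<le> Suc k \<Longrightarrow> 0 \<le> p i"
  using p_mono[of 0 i] p_0 by simp

text \<open>Zero at the right endpoint too, unlike the indicator in \<open>drift\<close>; the two
  differ there at a single time.\<close>

definition drift_on :: "nat \<Rightarrow> (nat \<Rightarrow> 'v) \<Rightarrow> real \<Rightarrow> 'v \<Rightarrow> 'v" where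
  "drift_on n Q s x =
     (if s \<in> {p n<..<p (Suc n)} then last_gradient (V s) n (h s) (extend_tuple n Q x) else 0)"

lemma monotone_evolution_drift_on:
  assumes n: "n \<le> k" "p n < p (Suc n)"
    and Q: "\<And>j. j < n \<Longrightarrow> Q j \<in> V (p n)" and x: "x \<in> V (p n)"
  shows "\<exists>K. monotone_evolution V (drift_on n Q) S x (p n) (p (Suc n)) L K"
proof -
  define a b where "a = p n" and "b = p (Suc n)"
  have ab: "0 \<le> a" "a < b"
    using n p_nonneg[of n] by (auto simp: a_def b_def)
  define N where "N = tuple_norm n (extend_tuple n Q 0)"
  have N: "N \<ge> 0" by (simp add: N_def tuple_norm_nonneg)
  define K where "K = 2 * C * (N + 1) + D"
  have tuples: "extend_tuple n Q y \<in> tuples (V s) n" if "a \<le> s" "y \<in> V s" for s y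
    using Q V_mono[of a s] that ab by (intro extend_tuple_in) (auto simp: a_def)
  have norm_tuple: "tuple_norm n (extend_tuple n Q y) \<le> N + norm y" for y
    unfolding N_def by (rule tuple_norm_extend_tuple)
  have "monotone_evolution V (drift_on n Q) S x a b L K"
  proof
    show "a < b" "0 \<le> L" "0 \<le> K"
      using ab L CD N by (auto simp: K_def)
    show "subspace (V t)" "closed (V t)" if "t \<in> {a..b}" for t
      using that ab V_subspace V_closed by auto
    show "V s \<subseteq> V t" if "a \<le> s" "s \<le> t" for s t
      using that ab by (intro V_mono) auto
    show "drift_on n Q s y = 0" if "s \<notin> {a<..<b}" for s y
      using that by (auto simp: drift_on_def a_def b_def)
    show "drift_on n Q s y \<in> V s" if "s \<in> {a<..<b}" "y \<in> V s" for s y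
      using that n(1) ab V_subspace[of s] V_closed[of s] tuples[of s y]
      by (auto simp: drift_on_def a_def b_def intro!: last_gradient(1) gateaux)
    show "norm (drift_on n Q s y) \<le> K * (1 + norm y)" if s: "s \<in> {a<..<b}" "y \<in> V s" for s y
    proof -
      have "norm (last_gradient (V s) n (h s) (extend_tuple n Q y))
          \<le> 2 * C * tuple_norm n (extend_tuple n Q y) + D"
        using s n(1) ab tuples[of s y] CD
        by (intro norm_last_gradient_le V_subspace V_closed gateaux lipschitz) (auto simp: a_def b_def)
      also have "\<dots> \<le> 2 * C * (N + norm y) + D"
        using CD norm_tuple by (intro add_right_mono mult_left_mono) auto
      also have "\<dots> \<le> K * (1 + norm y)"
        using CD N by (simp add: K_def algebra_simps)
      finally show ?thesis
        using s by (simp add: drift_on_def a_def b_def)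
    qed
    show "0 \<le> inner (y - z) (drift_on n Q s y - drift_on n Q s z)"
      if s: "s \<in> {a<..<b}" "y \<in> V s" "z \<in> V s" for s y z
    proof -
      have "Q j \<in> V s" if "j < n" for j
        using Q[OF that] V_mono[of a s] s ab by (auto simp: a_def)
      then have "0 \<le> inner (y - z) (last_gradient (V s) n (h s) (extend_tuple n Q y)
          - last_gradient (V s) n (h s) (extend_tuple n Q z))"
        using s n(1) ab
        by (intro last_gradient_monotone V_subspace V_closed gateaux convex) (auto simp: a_def b_def)
      then show ?thesis
        using s by (simp add: drift_on_def a_def b_def)
    qed
    show "\<exists>\<delta>>0. \<forall>s t y z. a < s \<and> s \<le> t \<and> t < b \<and> y \<in> V s \<and> z \<in> V t
        \<and> norm y \<le> R \<and> norm z \<le> R \<and> t - s < \<delta> \<and> norm (y - z) < \<delta>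
        \<longrightarrow> norm (drift_on n Q s y - drift_on n Q t z) < \<epsilon>" if \<epsilon>: "\<epsilon> > 0" for R \<epsilon>
    proof -
      \<comment> \<open>A common bound for the factors of both Hoelder estimates on the ball of
        radius \<open>R\<close>; the absolute value covers negative \<open>R\<close>.\<close>
      define B where "B = C + 2 * D * (N + \<bar>R\<bar>)"
      have B: "B \<ge> 0" using CD N by (simp add: B_def)
      obtain \<delta>1 where \<delta>1: "\<delta>1 > 0" "\<And>u. 0 \<le> u \<Longrightarrow> u < \<delta>1 \<Longrightarrow> u powr \<alpha> * B < \<epsilon> / 2"
        using powr_small[OF \<alpha> B, of "\<epsilon> / 2"] \<epsilon> by auto
      obtain \<delta>2 where \<delta>2: "\<delta>2 > 0" "\<And>u. 0 \<le> u \<Longrightarrow> u < \<delta>2 \<Longrightarrow> u powr \<beta> * B < \<epsilon> / 2"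
        using powr_small[OF \<beta> B, of "\<epsilon> / 2"] \<epsilon> by auto
      have "norm (drift_on n Q s y - drift_on n Q t z) < \<epsilon>"
        if st: "a < s" "s \<le> t" "t < b" and yz: "y \<in> V s" "z \<in> V t" "norm y \<le> R" "norm z \<le> R"
          and close: "t - s < min \<delta>1 \<delta>2" "norm (y - z) < min \<delta>1 \<delta>2" for s t y z
      proof -
        let ?Y = "extend_tuple n Q y" and ?Z = "extend_tuple n Q z"
        let ?g = "\<lambda>s. last_gradient (V s) n (h s)"
        have yt: "y \<in> V t"
          using yz(1) V_mono[of s t] st ab by auto
        have nY: "D * tuple_norm n ?Y \<le> D * (N + \<bar>R\<bar>)" and nZ: "D * tuple_norm n ?Z \<le> D * (N + \<bar>R\<bar>)"
          using CD(2) norm_tuple[of y] norm_tuple[of z] yz by (auto intro!: mult_left_mono)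
        \<comment> \<open>Time is changed first, at the state \<open>y\<close> of the earlier space
          as \<open>grad_time\<close> requires; then the state is changed at time \<open>t\<close>,
          where \<open>y\<close> and \<open>z\<close> both lie in \<open>V t\<close>.\<close>
        have "norm (?g s ?Y - ?g t ?Y) < \<epsilon> / 2"
        proof (cases "s = t")
          case False
          then have "norm (?g s ?Y - ?g t ?Y) \<le> \<bar>s - t\<bar> powr \<alpha> * (C + D * tuple_norm n ?Y)"
            using st n(1) tuples[of s y] yz by (intro grad_time) (auto simp: a_def b_def)
          also have "\<dots> \<le> \<bar>s - t\<bar> powr \<alpha> * B"
          proof (rule mult_left_mono)
            have "0 \<le> D * (N + \<bar>R\<bar>)" using CD N by simp
            then show "C + D * tuple_norm n ?Y \<le> B"
              using nY by (simp add: B_def)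
          qed simp
          also have "\<dots> < \<epsilon> / 2"
            using st close by (intro \<delta>1) auto
          finally show ?thesis .
        qed (use \<epsilon> in simp)
        moreover have "norm (?g t ?Y - ?g t ?Z) < \<epsilon> / 2"
        proof -
          have "norm (?g t ?Y - ?g t ?Z)
              \<le> tuple_norm n (?Y - ?Z) powr \<beta> * (C + D * tuple_norm n ?Y + D * tuple_norm n ?Z)"
            using st n(1) tuples[of t] yz yt by (intro grad_space) (auto simp: a_def b_def)
          also have "\<dots> \<le> norm (y - z) powr \<beta> * B"
            unfolding extend_tuple_diff tuple_norm_last_direction
            using nY nZ by (intro mult_left_mono) (auto simp: B_def)
          also have "\<dots> < \<epsilon> / 2"
            using close by (intro \<delta>2) auto
          finally show ?thesis .
        qed
        moreover have "norm (?g s ?Y - ?g t ?Z) \<le> norm (?g s ?Y - ?g t ?Y) + norm (?g t ?Y - ?g t ?Z)"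
          using norm_triangle_ineq[of "?g s ?Y - ?g t ?Y" "?g t ?Y - ?g t ?Z"] by simp
        ultimately have "norm (?g s ?Y - ?g t ?Z) < \<epsilon>" by linarith
        then show ?thesis
          using st by (simp add: drift_on_def a_def b_def)
      qed
      then show ?thesis
        using \<delta>1(1) \<delta>2(1) by (intro exI[of _ "min \<delta>1 \<delta>2"]) auto
    qed
    show "continuous_on {a..b} S"
      by (rule continuous_on_subset[OF S_continuous]) (use ab in auto)
    show "S t - S a \<in> V t" if "t \<in> {a..b}" for t
      using that ab S_in[of t] S_in[of a] V_mono[of a t] V_subspace[of t]
      by (intro subspace_diff) auto
    show "x \<in> V a" using x by (simp add: a_def)
  qed
  then show ?thesis by (auto simp: a_def b_def)
qed

lemma drift_eq:
  assumes n: "n \<le> k" and s: "s \<in> {p n<..p (Suc n)}"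
  shows "drift V h p k X s = last_gradient (V s) n (h s) (path_tuple p n X s)"
proof -
  have "indicator {p i<..p (Suc i)} s = (if i = n then 1 else 0 :: real)" if "i \<le> k" for i
  proof (cases i n rule: linorder_cases)
    case less
    then show ?thesis using p_mono[of "Suc i" n] n s by (auto simp: indicator_def)
  next
    case greater
    then show ?thesis using p_mono[of "Suc n" i] that s by (auto simp: indicator_def)
  qed (use s in simp)
  then have "drift V h p k X s =
      (\<Sum>i\<le>k. if i = n then last_gradient (V s) i (h s) (path_tuple p i X s) else 0)"
    unfolding drift_def by (intro sum.cong) auto
  then show ?thesis using n by simp
qed

text \<open>The drift is non-anticipating: a term with \<open>p i < s\<close> reads the path at grid
  points up to \<open>p i\<close> and at \<open>s\<close>, and the other terms have indicator 0.
  This makes gluing possible.\<close>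

lemma drift_cong:
  assumes "\<And>r. 0 \<le> r \<Longrightarrow> r \<le> s \<Longrightarrow> X r = Y r"
  shows "drift V h p k X s = drift V h p k Y s"
  unfolding drift_def
proof (intro sum.cong refl)
  fix i assume "i \<in> {..k}"
  then have i: "i \<le> k" by simp
  show "indicator {p i<..p (Suc i)} s *\<^sub>R last_gradient (V s) i (h s) (path_tuple p i X s) =
      indicator {p i<..p (Suc i)} s *\<^sub>R last_gradient (V s) i (h s) (path_tuple p i Y s)"
  proof (cases "p i < s")
    case True
    have "X (p (Suc j)) = Y (p (Suc j))" if "j < i" for j
      using that i True p_mono[of "Suc j" i] p_nonneg[of "Suc j"] by (intro assms) auto
    moreover have "X s = Y s"
      using True p_nonneg[of i] i by (intro assms) auto
    ultimately have "path_tuple p i X s = path_tuple p i Y s"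
      by (auto simp: path_tuple_def fun_eq_iff)
    then show ?thesis by simp
  qed simp
qed

lemma drift_on_eq:
  assumes "n \<le> k" "s \<in> {p n<..<p (Suc n)}" "\<And>j. j < n \<Longrightarrow> Q j = X (p (Suc j))"
  shows "drift_on n Q s (X s) = drift V h p k X s"
proof -
  have "extend_tuple n Q (X s) = path_tuple p n X s"
    using assms(3) by (auto simp: extend_tuple_def path_tuple_def fun_eq_iff)
  then show ?thesis
    using assms drift_eq[of n s X] by (auto simp: drift_on_def)
qed

section \<open>Localisation to one grid interval and gluing\<close>

abbreviation solution_until :: "real \<Rightarrow> (real \<Rightarrow> 'v) \<Rightarrow> bool" where
  "solution_until t X \<equiv> continuous_solution V h p k t L S x\<^sub>0 X"

lemma solution_until_le:
  assumes "solution_until t X" "s \<le> t"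
  shows "solution_until s X"
  using assms unfolding continuous_solution_def by (auto intro: continuous_on_subset)

lemma solution_until_initial:
  assumes "solution_until t X" "0 \<le> t"
  shows "X 0 = x\<^sub>0"
  using assms S_0 unfolding continuous_solution_def by auto

text \<open>Subtract the equation at \<open>p n\<close> from the one at \<open>t\<close>. The past
  \<open>Q\<close> is a separate parameter so that two solutions with the same past can be placed in
  one and the same frozen problem.\<close>

lemma solution_until_restrict:
  assumes n: "n \<le> k" "p n < p (Suc n)"
    and K: "monotone_evolution V (drift_on n Q) S (X (p n)) (p n) (p (Suc n)) L K"
    and X: "solution_until (p (Suc n)) X"
    and Q: "\<And>j. j < n \<Longrightarrow> Q j = X (p (Suc j))"
  shows "monotone_evolution.solution V (drift_on n Q) S (X (p n)) (p n) (p (Suc n)) L X"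
proof -
  interpret E: monotone_evolution V "drift_on n Q" S "X (p n)" "p n" "p (Suc n)" L K
    by (rule K)
  let ?F = "\<lambda>s. L *\<^sub>R X s - drift V h p k X s"
  have a: "0 \<le> p n" using n by (intro p_nonneg) simp
  have X': "\<And>t. 0 \<le> t \<Longrightarrow> t \<le> p (Suc n) \<Longrightarrow> X t \<in> V t" "continuous_on {0..p (Suc n)} X"
    "\<And>t. 0 \<le> t \<Longrightarrow> t \<le> p (Suc n) \<Longrightarrow> ?F integrable_on {0..t}"
    "\<And>t. 0 \<le> t \<Longrightarrow> t \<le> p (Suc n) \<Longrightarrow> X t = x\<^sub>0 + S t + integral {0..t} ?F"
    using X unfolding continuous_solution_def by auto
  have "E.adapted_path X"
    unfolding E.adapted_path_def using X'(1) a
    by (auto intro: continuous_on_subset[OF X'(2)])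
  moreover have "X t = E.evolve X t" if t: "t \<in> {p n..p (Suc n)}" for t
  proof -
    have "integral {p n..t} ?F = integral {p n..t} (E.field X)"
    proof (rule integral_spike)
      show "negligible {p n, p (Suc n)}" by simp
      show "E.field X s = ?F s" if "s \<in> {p n..t} - {p n, p (Suc n)}" for s
        unfolding E.field_def using that t n(1) drift_on_eq[where Q = Q and X = X and s = s, OF n(1) _ Q]
        by auto
    qed
    moreover have "integral {0..p n} ?F + integral {p n..t} ?F = integral {0..t} ?F"
      using t a X'(3)[of t] by (intro Henstock_Kurzweil_Integration.integral_combine) auto
    ultimately show ?thesis
      unfolding E.evolve_def using X'(4)[of t] X'(4)[of "p n"] t a
      by (simp add: algebra_simps)
  qed
  ultimately show ?thesis
    unfolding E.solution_def by (intro conjI ballI)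
qed

lemma path_in:
  assumes "n \<le> k" "solution_until t X" "p n \<le> t" "j < n"
  shows "X (p (Suc j)) \<in> V (p n)"
proof -
  have "p (Suc j) \<le> p n" "0 \<le> p (Suc j)"
    using assms by (auto intro: p_mono p_nonneg)
  moreover from this have "X (p (Suc j)) \<in> V (p (Suc j))"
    using assms by (auto simp: continuous_solution_def)
  ultimately show ?thesis
    using V_mono by blast
qed

text \<open>Induction over the grid: agreement up to \<open>p n\<close> gives both paths the same
  frozen drift and starting value, so uniqueness on one interval applies.\<close>

lemma solution_until_unique:
  assumes X: "solution_until (p (Suc k)) X" and Y: "solution_until (p (Suc k)) Y"
    and t: "t \<in> {0..p (Suc k)}"
  shows "X t = Y t"
proof -
  have "\<forall>t\<in>{0..p n}. X t = Y t" if "n \<le> Suc k" for n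
    using that
  proof (induction n)
    case 0
    have "0 \<le> p (Suc k)" by (rule p_nonneg) simp
    then show ?case
      using solution_until_initial[OF X] solution_until_initial[OF Y] p_0 by simp
  next
    case (Suc n)
    then have n: "n \<le> k" by simp
    have IH: "X s = Y s" if "0 \<le> s" "s \<le> p n" for s
      using Suc that by simp
    show ?case
    proof (cases "p n < p (Suc n)")
      case True
      have le: "p n \<le> p (Suc k)" "p (Suc n) \<le> p (Suc k)" "0 \<le> p n"
        using n by (auto intro: p_mono p_nonneg)
      let ?Q = "\<lambda>j. X (p (Suc j))"
      have "X (p n) \<in> V (p n)"
        using X le by (auto simp: continuous_solution_def)
      then obtain K where K: "monotone_evolution V (drift_on n ?Q) S (X (p n)) (p n) (p (Suc n)) L K"
        using monotone_evolution_drift_on[OF n True, of ?Q] path_in[OF n X le(1)] by blast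
      then interpret E: monotone_evolution V "drift_on n ?Q" S "X (p n)" "p n" "p (Suc n)" L K .
      have Xn: "X (p n) = Y (p n)"
        using IH le by simp
      have "E.solution X"
        by (rule solution_until_restrict[OF n True K solution_until_le[OF X le(2)] refl])
      \<comment> \<open>\<open>E\<close> is built from the past of \<open>X\<close>; the induction
        hypothesis turns this into the past and the starting value of \<open>Y\<close>.\<close>
      moreover have "E.solution Y"
        unfolding Xn
      proof (rule solution_until_restrict[OF n True K[unfolded Xn] solution_until_le[OF Y le(2)]])
        show "X (p (Suc j)) = Y (p (Suc j))" if "j < n" for j
          using that n by (intro IH p_nonneg p_mono) auto
      qed
      ultimately have "X s = Y s" if "p n \<le> s" "s \<le> p (Suc n)" for s
        using E.solution_unique that by auto
      then show ?thesis
        using IH by (metis atLeastAtMost_iff linear)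
    next
      case False
      then show ?thesis using IH by auto
    qed
  qed
  then show ?thesis using t by blast
qed

lemma solution_until_exists:
  assumes "n \<le> Suc k"
  shows "\<exists>X. solution_until (p n) X"
  using assms
proof (induction n)
  case 0
  have "solution_until 0 (\<lambda>_. x\<^sub>0)"
    using x\<^sub>0 S_0 integrable_on_refl[of "\<lambda>s. L *\<^sub>R x\<^sub>0 - drift V h p k (\<lambda>_. x\<^sub>0) s" 0]
    by (auto simp: continuous_solution_def)
  then show ?case using p_0 by auto
next
  case (Suc n)
  then obtain X where X: "solution_until (p n) X" by auto
  have n: "n \<le> k" using Suc by simp
  show ?case
  proof (cases "p n < p (Suc n)")
    case False
    then have "p n = p (Suc n)" using p_step[OF n] by simp
    then show ?thesis using X by auto
  next
    case True
    define a b where "a = p n" and "b = p (Suc n)"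
    have a: "0 \<le> a" "a < b"
      using n True by (auto simp: a_def b_def intro: p_nonneg)
    let ?Q = "\<lambda>j. X (p (Suc j))"
    let ?F = "\<lambda>X s. L *\<^sub>R X s - drift V h p k X s"
    have X': "\<And>t. 0 \<le> t \<Longrightarrow> t \<le> a \<Longrightarrow> X t \<in> V t" "continuous_on {0..a} X"
      "\<And>t. 0 \<le> t \<Longrightarrow> t \<le> a \<Longrightarrow> ?F X integrable_on {0..t}"
      "\<And>t. 0 \<le> t \<Longrightarrow> t \<le> a \<Longrightarrow> X t = x\<^sub>0 + S t + integral {0..t} (?F X)"
      using X unfolding continuous_solution_def a_def by auto
    obtain K where "monotone_evolution V (drift_on n ?Q) S (X a) a b L K"
      using monotone_evolution_drift_on[OF n True, of ?Q] path_in[OF n X order_refl] X'(1)[of a] a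
      unfolding a_def b_def by blast
    then interpret E: monotone_evolution V "drift_on n ?Q" S "X a" a b L K .
    obtain x where x: "E.solution x"
      by (rule E.solution_exists)
    then have adapted: "E.adapted_path x" and x_eq: "\<And>t. t \<in> {a..b} \<Longrightarrow> x t = E.evolve x t"
      by (auto simp: E.solution_def)
    have x_a: "x a = X a"
      using x_eq[of a] a by (simp add: E.evolve_def)
    \<comment> \<open>The value at the junction is unambiguous since
      \<open>x a = X a\<close>.\<close>
    define Z where "Z t = (if t \<le> a then X t else x t)" for t
    have Z_X: "Z t = X t" if "t \<le> a" for t
      using that by (simp add: Z_def)
    have Z_x: "Z t = x t" if "a \<le> t" for t
      using that x_a by (auto simp: Z_def)
    \<comment> \<open>\<open>X\<close> is arbitrary beyond \<open>a\<close>, but the drift at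
      \<open>s \<le> a\<close> does not look that far.\<close>
    have F_X: "?F Z s = ?F X s" if "s \<le> a" for s
      using that drift_cong[of s Z X] Z_X by simp
    have F_x: "?F Z s = E.field x s" if "s \<in> {a<..<b}" for s
    proof -
      have "drift_on n ?Q s (Z s) = drift V h p k Z s"
      proof (rule drift_on_eq[OF n])
        show "X (p (Suc j)) = Z (p (Suc j))" if "j < n" for j
          using that n p_mono[of "Suc j" n] by (simp add: Z_X a_def)
      qed (use that in \<open>simp add: a_def b_def\<close>)
      then show ?thesis
        using that by (simp add: E.field_def Z_x)
    qed
    have int_X: "(?F Z has_integral integral {0..t} (?F X)) {0..t}" if "0 \<le> t" "t \<le> a" for t
      using integrable_integral[OF X'(3)[OF that]] F_X that
      by (subst has_integral_cong[of _ _ "?F X"]) auto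
    have int_x: "(?F Z has_integral integral {a..t} (E.field x)) {a..t}" if "t \<in> {a..b}" for t
    proof (rule has_integral_spike_finite)
      show "(E.field x has_integral integral {a..t} (E.field x)) {a..t}"
        using that by (intro integrable_integral E.field_integrable adapted) simp
      show "?F Z s = E.field x s" if "s \<in> {a..t} - {a, b}" for s
        using that \<open>t \<in> {a..b}\<close> by (intro F_x) auto
    qed simp
    have "solution_until b Z"
      unfolding continuous_solution_def
    proof (intro conjI ballI)
      show "Z t \<in> V t" if "t \<in> {0..b}" for t
        using that X'(1)[of t] adapted by (auto simp: Z_def E.adapted_path_def)
      have "continuous_on ({0..a} \<union> {a..b}) Z"
      proof (rule continuous_on_closed_Un)
        show "continuous_on {0..a} Z"
          using X'(2) by (rule continuous_on_eq) (simp add: Z_X)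
        have "continuous_on {a..b} x"
          using adapted by (simp add: E.adapted_path_def)
        then show "continuous_on {a..b} Z"
          by (rule continuous_on_eq) (simp add: Z_x)
      qed auto
      then show "continuous_on {0..b} Z"
        using a by (simp add: ivl_disj_un_two_touch)
      fix t assume t: "t \<in> {0..b}"
      \<comment> \<open>Stated with \<open>has_integral\<close>, so that integrability and the value
        of the integral come together.\<close>
      have "(?F Z has_integral Z t - (x\<^sub>0 + S t)) {0..t}"
      proof (cases "t \<le> a")
        case True
        then show ?thesis
          using int_X[of t] X'(4)[of t] t by (simp add: Z_X)
      next
        case False
        have "(?F Z has_integral integral {0..a} (?F X) + integral {a..t} (E.field x)) {0..t}"
          using False a t by (intro has_integral_combine[OF _ _ int_X int_x]) auto
        moreover have "Z t = X a + (S t - S a) + integral {a..t} (E.field x)"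
          using False t x_eq[of t] by (simp add: Z_x E.evolve_def)
        ultimately show ?thesis
          using X'(4)[of a] a by (simp add: algebra_simps)
      qed
      then show "?F Z integrable_on {0..t}" "Z t = x\<^sub>0 + S t + integral {0..t} (?F Z)"
        by (auto simp: integral_unique)
    qed
    then show ?thesis by (auto simp: b_def)
  qed
qed

end

theorem theorem4p3:
  fixes M :: "('h::complex_hilbert \<Rightarrow>\<^sub>L 'h) set"
    and \<tau> :: "('h \<Rightarrow>\<^sub>L 'h) \<Rightarrow> complex"
    and \<iota> :: "('h \<Rightarrow>\<^sub>L 'h) \<Rightarrow> 'l::complex_hilbert"
    and Mt :: "real \<Rightarrow> ('h \<Rightarrow>\<^sub>L 'h) set"
    and S :: "real \<Rightarrow> 'm::finite \<Rightarrow> ('h \<Rightarrow>\<^sub>L 'h)"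
    and V :: "real \<Rightarrow> ('l ^ 'm) set"
    and h :: "real \<Rightarrow> (nat \<Rightarrow> 'l ^ 'm) \<Rightarrow> real"
    and p :: "nat \<Rightarrow> real" and k :: nat
    and T L c C D \<alpha> \<beta> :: real
    and X0 :: "'l ^ 'm"
  assumes M: "tracial_von_neumann_algebra M \<tau>"
    and L2: "L2_completion M \<tau> \<iota>"
    and filtration: "vn_filtration M Mt"
    and brownian: "adapted_free_brownian_motion \<tau> Mt S"
    and V_def: "\<And>t. V t = L2_sa_vec M \<iota> (Mt t)"
    and T: "T > 0"
    and p_0: "p 0 = 0"
    and p_less: "\<And>i. i < k \<Longrightarrow> p i < p (Suc i)"
    and p_last: "p k \<le> p (Suc k)" "p (Suc k) = T"
    and p_step: "\<And>i. i \<le> k \<Longrightarrow> \<bar>p (Suc i) - p i\<bar> \<le> 1"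
    and convex: "\<And>i t. \<lbrakk>i \<le> k; t \<in> {p i<..p (Suc i)}\<rbrakk>
      \<Longrightarrow> convex_on (tuples (V t) i) (h t)"
    and lower: "\<And>i t X. \<lbrakk>i \<le> k; t \<in> {p i<..p (Suc i)}; X \<in> tuples (V t) i\<rbrakk>
      \<Longrightarrow> c \<le> h t X"
    and upper: "\<And>i t X. \<lbrakk>i \<le> k; t \<in> {p i<..p (Suc i)}; X \<in> tuples (V t) i\<rbrakk>
      \<Longrightarrow> h t X \<le> \<bar>c\<bar> * (1 + (tuple_norm i X)\<^sup>2)"
    and CD: "C > 0" "D > 0"
    and lipschitz: "\<And>i t X Y. \<lbrakk>i \<le> k; t \<in> {p i<..p (Suc i)};
        X \<in> tuples (V t) i; Y \<in> tuples (V t) i\<rbrakk>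
      \<Longrightarrow> \<bar>h t X - h t Y\<bar> \<le>
            tuple_norm i (X - Y) * (C * tuple_norm i X + C * tuple_norm i Y + D)"
    and gateaux: "\<And>i t X. \<lbrakk>i \<le> k; t \<in> {p i<..p (Suc i)}; X \<in> tuples (V t) i\<rbrakk>
      \<Longrightarrow> gateaux_differentiable (V t) i (h t) X"
    and grad_continuous: "\<And>i X. i \<le> k
      \<Longrightarrow> continuous_on {t \<in> {p i<..<p (Suc i)}. X \<in> tuples (V t) i}
            (\<lambda>t. last_gradient (V t) i (h t) X)"
    and grad_adapted: "\<And>i t u X. \<lbrakk>i \<le> k; t \<in> {p i<..p (Suc i)}; 0 \<le> u; u < t;
        X \<in> tuples (V u) i\<rbrakk>
      \<Longrightarrow> last_gradient (V t) i (h t) X \<in> V u"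
    and \<alpha>: "\<alpha> \<in> {0<..1}" and \<beta>: "\<beta> \<in> {0<..1}"
    and grad_time: "\<And>i t s X. \<lbrakk>i \<le> k; t \<in> {p i<..<p (Suc i)}; s \<in> {p i<..<p (Suc i)}; t < s;
        X \<in> tuples (V t) i\<rbrakk>
      \<Longrightarrow> norm (last_gradient (V t) i (h t) X - last_gradient (V s) i (h s) X) \<le>
            \<bar>t - s\<bar> powr \<alpha> * (C + D * tuple_norm i X)"
    and grad_space: "\<And>i t X Y. \<lbrakk>i \<le> k; t \<in> {p i<..<p (Suc i)};
        X \<in> tuples (V t) i; Y \<in> tuples (V t) i\<rbrakk>
      \<Longrightarrow> norm (last_gradient (V t) i (h t) X - last_gradient (V t) i (h t) Y) \<le>
            tuple_norm i (X - Y) powr \<beta> * (C + D * tuple_norm i X + D * tuple_norm i Y)"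
    and X0: "X0 \<in> V 0"
    and L: "L > 0"
  shows "\<exists>X. continuous_solution V h p k T L (\<lambda>t. L2_vec \<iota> (S t)) X0 X
    \<and> (\<forall>Y. continuous_solution V h p k T L (\<lambda>t. L2_vec \<iota> (S t)) (Y 0) Y \<and> Y 0 = X0
          \<longrightarrow> (\<forall>t\<in>{0..T}. Y t = X t))"
proof -
  let ?S = "\<lambda>t. L2_vec \<iota> (S t)"
  have Mt: "von_neumann_algebra (Mt t)" "Mt t \<subseteq> M" if "t \<ge> 0" for t
    using filtration that by (auto simp: vn_filtration_def)
  interpret gradient_evolution V h p k L C D \<alpha> \<beta> ?S X0
  proof
    fix t :: real assume t: "t \<ge> 0"
    show "subspace (V t)" "closed (V t)"
      unfolding V_def by (rule L2_sa_vec_subspace_closed[OF M L2 Mt[OF t]])+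
    have "S t j \<in> self_adjoint_part (Mt t)" for j
      using brownian t by (simp add: adapted_free_brownian_motion_def)
    then show "?S t \<in> V t"
      unfolding V_def by (rule L2_vec_in_L2_sa_vec[OF M L2 Mt(2)[OF t]])
  next
    show "V s \<subseteq> V t" if "0 \<le> s" "s \<le> t" for s t
      unfolding V_def using filtration that by (intro L2_sa_vec_mono) (auto simp: vn_filtration_def)
    show "p i \<le> p (Suc i)" if "i \<le> k" for i
      using that p_less[of i] p_last(1) by (cases "i = k") auto
    show "continuous_on {0..} ?S"
      by (rule continuous_on_free_Brownian_motion[OF M L2 filtration brownian])
    \<comment> \<open>\<open>\<iota> 0 = 0\<close> is drawn from additivity of
      \<open>\<iota>\<close> on \<open>M\<close>, for which \<open>0 \<in> M\<close> is
      needed.\<close>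
    have "subspace M"
      using M by (simp add: tracial_von_neumann_algebra_def subspace_von_neumann_algebra)
    then have "\<iota> (0 - 0) = \<iota> 0 - \<iota> 0"
      by (intro L2_embedding_diff[OF M L2] subspace_0)
    then show "?S 0 = 0"
      using brownian by (simp add: adapted_free_brownian_motion_def L2_vec_def vec_eq_iff)
    show "norm (last_gradient (V t) i (h t) X - last_gradient (V s) i (h s) X)
        \<le> \<bar>t - s\<bar> powr \<alpha> * (C + D * tuple_norm i X)"
      if "i \<le> k" "t \<in> {p i<..<p (Suc i)}" "s \<in> {p i<..<p (Suc i)}" "t < s" "X \<in> tuples (V t) i"
      for i t s X
      using that by (rule grad_time)
  qed (use p_0 L CD \<alpha> \<beta> X0 in
      \<open>auto intro: convex lipschitz gateaux grad_space\<close>)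
  obtain X where X: "continuous_solution V h p k T L ?S X0 X"
    using solution_until_exists[of "Suc k"] p_last(2) by auto
  moreover have "Y t = X t"
    if "continuous_solution V h p k T L ?S (Y 0) Y" "Y 0 = X0" "t \<in> {0..T}" for Y t
    using solution_until_unique[of Y X t] X that p_last(2) by simp
  ultimately show ?thesis by blast
qed

end
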